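(* Let $T$ be a bounded operator on a complex separable Banach space $X$ having type $p\in(1,2]$. Assume there is a finite constant $C$ such that for every nonempty open $\Omega\subset X$ with $T^{-1}(\Omega)\subset\Omega$, one can find a finite family $(u_k)_{k\in K}$ of unimodular eigenvectors of $T$ whose associated eigenvalues $(\lambda_k)_{k\in K}$ form an independent family, such that $\sum_k u_k\in\Omega$ and $\sum_k\|u_k\|^p\le C$. Then $\overline{\mathcal S}_T(HC(T))$ is a dense $G_\delta$ subset of $\overline{\mathcal S}_T(X)$.
   Context: $X$ has type $p$ if there is $C'$ with $\mathbb E\|\sum_n\varepsilon_nx_n\|^p\le C'\sum_n\|x_n\|^p$ for all finite sequences $(x_n)$, $\varepsilon_n$ independent Rademacher variables. A family $(\lambda_k)_{k\in K}\subset\mathbb T$ is independent if $\prod_k\lambda_k^{m_k}=1$ with $m_k\in\mathbb Z$ forces all $m_k=0$. A Steinhaus measure for $T$ is the distribution of $\sum_{j\in J}\chi_jx_j$, $J$ finite, $x_j$ unimodular eigenvectors of $T$, $\chi_j$ independent and uniformly distributed on $\mathbb T$; $\overline{\mathcal S}_T(X)$ is the closure of the set of Steinhaus measures in the Prokhorov topology, and $\overline{\mathcal S}_T(A)=\{m\in\overline{\mathcal S}_T(X):m(A)=1\}$. $HC(T)$ is the set of vectors with dense orbit. *)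

theory Defs
  imports "HOL-Probability.Probability"
begin

class complex_normed_vector = real_normed_vector +
  fixes scaleC :: "complex \<Rightarrow> 'a \<Rightarrow> 'a" (infixr "*\<^sub>C" 75)
  assumes scaleC_add_right: "a *\<^sub>C (x + y) = a *\<^sub>C x + a *\<^sub>C y"
    and scaleC_add_left: "(a + b) *\<^sub>C x = a *\<^sub>C x + b *\<^sub>C x"
    and scaleC_scaleC: "a *\<^sub>C (b *\<^sub>C x) = (a * b) *\<^sub>C x"
    and scaleC_one: "1 *\<^sub>C x = x"
    and scaleC_of_real: "(complex_of_real r) *\<^sub>C x = r *\<^sub>R x"
    and norm_scaleC: "norm (a *\<^sub>C x) = cmod a * norm x"

class complex_separable_banach = complex_normed_vector + banach + second_countable_topology

definition bounded_operator :: "('a::complex_normed_vector \<Rightarrow> 'a) \<Rightarrow> bool" where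
  "bounded_operator T \<longleftrightarrow> bounded_linear T \<and> (\<forall>c x. T (c *\<^sub>C x) = c *\<^sub>C T x)"

text \<open>Type p: expectation over independent Rademacher signs written as the average
  over all sign vectors.\<close>
definition has_type :: "real \<Rightarrow> 'a::real_normed_vector itself \<Rightarrow> bool" where
  "has_type p _ \<longleftrightarrow> (\<exists>C'. \<forall>(n::nat) (x::nat \<Rightarrow> 'a).
     (\<Sum>\<epsilon>\<in>PiE {..<n} (\<lambda>_. {-1, 1::real}). norm (\<Sum>i<n. \<epsilon> i *\<^sub>R x i) powr p) / 2 ^ n
       \<le> C' * (\<Sum>i<n. norm (x i) powr p))"

definition unimodular_eigenvector :: "('a::complex_normed_vector \<Rightarrow> 'a) \<Rightarrow> 'a \<Rightarrow> complex \<Rightarrow> bool" where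
  "unimodular_eigenvector T x c \<longleftrightarrow> x \<noteq> 0 \<and> cmod c = 1 \<and> T x = c *\<^sub>C x"

definition independent_family :: "'k set \<Rightarrow> ('k \<Rightarrow> complex) \<Rightarrow> bool" where
  "independent_family K lam \<longleftrightarrow>
     (\<forall>m::'k \<Rightarrow> int. (\<Prod>k\<in>K. lam k powi m k) = 1 \<longrightarrow> (\<forall>k\<in>K. m k = 0))"

definition circle_uniform :: "complex measure" where
  "circle_uniform = distr (uniform_measure lborel {0..2*pi}) borel (\<lambda>t. cis t)"

definition steinhaus_measures :: "('a::complex_normed_vector \<Rightarrow> 'a) \<Rightarrow> 'a measure set" where
  "steinhaus_measures T = {distr (PiM J (\<lambda>_. circle_uniform)) borel (\<lambda>ch. \<Sum>j\<in>J. ch j *\<^sub>C x j) | J x.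
      finite (J::nat set) \<and> (\<forall>j\<in>J. \<exists>c. unimodular_eigenvector T (x j) c)}"

definition borel_probs :: "'a::topological_space measure set" where
  "borel_probs = {M. sets M = sets borel \<and> prob_space M}"

definition eps_nbhd :: "'a::metric_space set \<Rightarrow> real \<Rightarrow> 'a set" where
  "eps_nbhd A e = (\<Union>a\<in>A. ball a e)"

definition prokhorov_dist :: "'a::metric_space measure \<Rightarrow> 'a measure \<Rightarrow> real" where
  "prokhorov_dist M N = Inf {e. e > 0 \<and> (\<forall>A\<in>sets borel.
      measure M A \<le> measure N (eps_nbhd A e) + e \<and> measure N A \<le> measure M (eps_nbhd A e) + e)}"

definition prokhorov_topology :: "'a::metric_space measure topology" where
  "prokhorov_topology = topology (\<lambda>U. U \<subseteq> borel_probs \<and>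
     (\<forall>M\<in>U. \<exists>e>0. \<forall>N\<in>borel_probs. prokhorov_dist M N < e \<longrightarrow> N \<in> U))"

definition steinhaus_closure :: "('a::complex_separable_banach \<Rightarrow> 'a) \<Rightarrow> 'a measure set" where
  "steinhaus_closure T = prokhorov_topology closure_of steinhaus_measures T"

definition steinhaus_closure_on :: "('a::complex_separable_banach \<Rightarrow> 'a) \<Rightarrow> 'a set \<Rightarrow> 'a measure set" where
  "steinhaus_closure_on T A = {m \<in> steinhaus_closure T. emeasure m A = 1}"

definition HC :: "('a::metric_space \<Rightarrow> 'a) \<Rightarrow> 'a set" where
  "HC T = {x. closure (range (\<lambda>n. (T ^^ n) x)) = UNIV}"

end

theory Submission
  imports Defs
begin

text \<open>
  No Baire category argument is needed for density: starting from a Steinhaus sum \<open>Y\<^sub>0\<close> one builds a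
  random series \<open>X = Y\<^sub>0 + \<Sum>\<^sub>i B\<^sub>i\<close> of independent Steinhaus blocks that is almost surely hypercyclic and
  whose distribution is close to that of \<open>Y\<^sub>0\<close>. The hypothesis, applied to \<open>\<Union>\<^sub>n T\<^sup>-\<^sup>n(N W)\<close> and rescaled
  by \<open>1/N\<close>, yields eigenvectors with sum near a prescribed \<open>w\<close> and \<open>\<Sum> norm (u k) powr p\<close> as small as
  desired. At most \<open>card J\<close> of their eigenvalues depend on a given finite family \<open>J\<close> of
  eigenvalues; the corresponding vectors are tiny and can be dropped. By Kronecker's theorem some
  \<open>T\<^sup>n\<close> then almost fixes the previously chosen sum while sending the new block near \<open>w\<close>. Type \<open>p\<close> makes
  the later blocks so small that they do not disturb this, and since the prescribed vectors
  \<open>w\<^sub>0, w\<^sub>1, \<dots>\<close> come close to every vector infinitely often, the orbit of \<open>X\<close> is dense.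
\<close>

section \<open>The Prokhorov topology\<close>

text \<open>The time \<open>n\<close> depends on \<open>\<omega>\<close>: the random phases of a new
  block are undone by steering each \<open>lam k ^ n\<close> to \<open>cnj (\<omega> k)\<close>. On
  the old family the target is \<open>1\<close>, which is compatible with every multiplicative
  relation that may hold there. So the new eigenvalues need only be independent modulo the old ones;
  the hypothesis does not give this directly, since a family independent in itself may be related to
  the old eigenvalues or even repeat them. The dependence on \<open>\<omega>\<close> is also the
  obstacle to controlling later blocks, which must stay small under every \<open>T ^^ n\<close> that
  may occur. Compactness of the torus bounds all these times by one \<open>N\<close>, hence these
  operators by one constant \<open>M (Suc i)\<close>, and the next increments are made small
  relative to it. Since \<open>T ^^ n\<close> leaves the old sum almost in place, reaching
  \<open>v\<close> requires the new block to produce roughly \<open>v - X \<omega>\<close>. This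
  vector is random, so the targets \<open>w i\<close> must approximate every vector at arbitrarily
  late indices. All sums live on one probability space, so that closeness of distributions reduces
  to closeness in probability.\<close>

lemma openin_prokhorov:
  "openin prokhorov_topology U \<longleftrightarrow> U \<subseteq> borel_probs \<and>
     (\<forall>M\<in>U. \<exists>e>0. \<forall>N\<in>borel_probs. prokhorov_dist M N < e \<longrightarrow> N \<in> U)"
proof -
  let ?P = "\<lambda>U::'a measure set. U \<subseteq> borel_probs \<and>
     (\<forall>M\<in>U. \<exists>e>0. \<forall>N\<in>borel_probs. prokhorov_dist M N < e \<longrightarrow> N \<in> U)"
  have "istopology ?P"
    unfolding istopology_def
  proof (intro conjI allI impI)
    fix S T assume S: "?P S" and T: "?P T"
    show "S \<inter> T \<subseteq> borel_probs" using S by blast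
    show "\<forall>M\<in>S \<inter> T. \<exists>e>0. \<forall>N\<in>borel_probs. prokhorov_dist M N < e \<longrightarrow> N \<in> S \<inter> T"
    proof
      fix M assume "M \<in> S \<inter> T"
      then obtain d e where "d > 0" "e > 0"
        "\<forall>N\<in>borel_probs. prokhorov_dist M N < d \<longrightarrow> N \<in> S"
        "\<forall>N\<in>borel_probs. prokhorov_dist M N < e \<longrightarrow> N \<in> T"
        using S T by blast
      then show "\<exists>e>0. \<forall>N\<in>borel_probs. prokhorov_dist M N < e \<longrightarrow> N \<in> S \<inter> T"
        by (intro exI[of _ "min d e"]) auto
    qed
  next
    fix \<K> assume K: "\<forall>K\<in>\<K>. ?P K"
    then show "\<Union>\<K> \<subseteq> borel_probs" by blast
    show "\<forall>M\<in>\<Union>\<K>. \<exists>e>0. \<forall>N\<in>borel_probs. prokhorov_dist M N < e \<longrightarrow> N \<in> \<Union>\<K>"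
    proof
      fix M assume "M \<in> \<Union>\<K>"
      then obtain S where "S \<in> \<K>" "M \<in> S" by blast
      with K obtain e where "e > 0" "\<forall>N\<in>borel_probs. prokhorov_dist M N < e \<longrightarrow> N \<in> S" by blast
      with \<open>S \<in> \<K>\<close> show "\<exists>e>0. \<forall>N\<in>borel_probs. prokhorov_dist M N < e \<longrightarrow> N \<in> \<Union>\<K>" by blast
    qed
  qed
  then show ?thesis
    unfolding prokhorov_topology_def by (simp add: topology_inverse')
qed

lemma topspace_prokhorov: "topspace prokhorov_topology = borel_probs"
proof
  show "topspace prokhorov_topology \<subseteq> (borel_probs :: 'a measure set)"
    using openin_topspace[of "prokhorov_topology :: 'a measure topology"]
    unfolding openin_prokhorov by blast
  have "openin prokhorov_topology (borel_probs :: 'a measure set)"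
    unfolding openin_prokhorov by (auto intro: exI[of _ 1])
  then show "(borel_probs :: 'a measure set) \<subseteq> topspace prokhorov_topology"
    by (rule openin_subset)
qed

lemma prokhorov_dist_leI:
  assumes "e > 0"
    and "\<And>A. A \<in> sets borel \<Longrightarrow> measure M A \<le> measure N (eps_nbhd A e) + e"
    and "\<And>A. A \<in> sets borel \<Longrightarrow> measure N A \<le> measure M (eps_nbhd A e) + e"
  shows "prokhorov_dist M N \<le> e"
  unfolding prokhorov_dist_def using assms
  by (intro cInf_lower) (auto intro!: bdd_belowI[of _ 0])

lemma prokhorov_dist_lessD:
  fixes M N :: "'a::metric_space measure"
  assumes "M \<in> borel_probs" "N \<in> borel_probs" "prokhorov_dist M N < e"
  obtains d where "0 < d" "d < e"
    and "\<And>A. A \<in> sets borel \<Longrightarrow> measure M A \<le> measure N (eps_nbhd A d) + d"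
proof -
  interpret M: prob_space M using assms by (simp add: borel_probs_def)
  interpret N: prob_space N using assms by (simp add: borel_probs_def)
  let ?S = "{e. e > 0 \<and> (\<forall>A\<in>sets borel.
      measure M A \<le> measure N (eps_nbhd A e) + e \<and> measure N A \<le> measure M (eps_nbhd A e) + e)}"
  have "measure M A \<le> measure N B + 1" "measure N A \<le> measure M B + 1" for A B
    using M.prob_le_1[of A] N.prob_le_1[of A] measure_nonneg[of N B] measure_nonneg[of M B]
    by linarith+
  \<comment> \<open>Probabilities are at most 1, so 1 is always admissible; without a member the
    real \<open>Inf\<close> would carry no information.\<close>
  then have "1 \<in> ?S" by auto
  then have "?S \<noteq> {}" by blast
  moreover have "Inf ?S < e" using assms(3) by (simp add: prokhorov_dist_def)
  ultimately obtain d where "d \<in> ?S" "d < e"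
    using cInf_lessD[of ?S e] by (auto simp del: mem_Collect_eq)
  then show ?thesis using that[of d] by simp
qed

text \<open>Mass on an open set is lower semicontinuous: almost all of it sits on a closed set at
  positive distance from the complement of \<open>U\<close>, and a Prokhorov-small change cannot
  carry that part outside \<open>U\<close>.\<close>

lemma openin_prokhorov_measure_gt:
  fixes U :: "'a::metric_space set"
  assumes "open U"
  shows "openin prokhorov_topology {M \<in> borel_probs. measure M U > a}"
  unfolding openin_prokhorov
proof (intro conjI ballI)
  fix M :: "'a measure" assume "M \<in> {M \<in> borel_probs. measure M U > a}"
  then have M: "M \<in> borel_probs" and gt: "measure M U > a" by auto
  interpret M: prob_space M using M by (simp add: borel_probs_def)
  have sM: "sets M = sets borel" using M by (simp add: borel_probs_def)
  \<comment> \<open>An exhaustion of \<open>U\<close> from inside by closed sets whose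
    \<open>d\<close>-neighbourhoods stay in \<open>U\<close> for every
    \<open>d < 1 / real (Suc n)\<close>.\<close>
  define F where "F n = {x. ball x (1 / real (Suc n)) \<subseteq> U}" for n
  have Fcl: "closed (F n)" for n
  proof -
    have "open (- F n)"
      unfolding open_dist
    proof
      fix x assume "x \<in> - F n"
      then obtain y where y: "dist x y < 1 / real (Suc n)" "y \<notin> U"
        unfolding F_def using mem_ball by blast
      have "z \<in> - F n" if "dist z x < 1 / real (Suc n) - dist x y" for z
      proof -
        have "y \<in> ball z (1 / real (Suc n))"
          unfolding mem_ball using dist_triangle[of z y x] that by linarith
        then show ?thesis unfolding F_def using y(2) by blast
      qed
      then show "\<exists>e>0. \<forall>z. dist z x < e \<longrightarrow> z \<in> - F n"
        using y(1) by (intro exI[of _ "1 / real (Suc n) - dist x y"] conjI allI impI) linarith+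
    qed
    then show ?thesis by (simp add: closed_def)
  qed
  have Fin: "F n \<subseteq> F (Suc n)" for n
  proof -
    have "1 / real (Suc (Suc n)) \<le> 1 / real (Suc n)" by (simp add: frac_le)
    then show ?thesis unfolding F_def using subset_ball[of "1 / real (Suc (Suc n))" "1 / real (Suc n)"] by blast
  qed
  have UF: "(\<Union>n. F n) = U"
  proof
    show "U \<subseteq> (\<Union>n. F n)"
    proof
      fix x assume "x \<in> U"
      then obtain e where e: "e > 0" "ball x e \<subseteq> U" using assms openE by blast
      obtain n where "1 / real (Suc n) < e" using nat_approx_posE[OF e(1)] by auto
      then show "x \<in> (\<Union>n. F n)"
        unfolding F_def using e(2) subset_ball[of "1 / real (Suc n)" e x] by (intro UN_I[of n]) auto
    qed
    show "(\<Union>n. F n) \<subseteq> U"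
    proof
      fix x assume "x \<in> (\<Union>n. F n)"
      then obtain n where "ball x (1 / real (Suc n)) \<subseteq> U" unfolding F_def by blast
      moreover have "x \<in> ball x (1 / real (Suc n))" by simp
      ultimately show "x \<in> U" by blast
    qed
  qed
  have "(\<lambda>n. measure M (F n)) \<longlonglongrightarrow> measure M (\<Union>n. F n)"
    using Fcl sM by (intro M.finite_Lim_measure_incseq incseq_SucI Fin) auto
  \<comment> \<open>One \<open>n\<close> has to serve twice: \<open>F n\<close> must carry enough
    mass even after the additive Prokhorov error, itself below \<open>1 / real (Suc n)\<close>, is
    subtracted.\<close>
  then have "(\<lambda>n. measure M (F n) - 1 / real (Suc n)) \<longlonglongrightarrow> measure M U - 0"
    unfolding UF by (intro tendsto_diff LIMSEQ_Suc lim_1_over_n)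
  then have "eventually (\<lambda>n. measure M (F n) - 1 / real (Suc n) > a) sequentially"
    using gt by (simp add: order_tendstoD(1))
  then obtain n where n: "measure M (F n) - 1 / real (Suc n) > a"
    using eventually_happens sequentially_bot by blast
  show "\<exists>e>0. \<forall>N\<in>borel_probs. prokhorov_dist M N < e \<longrightarrow> N \<in> {M \<in> borel_probs. a < measure M U}"
  proof (intro exI[of _ "1 / real (Suc n)"] conjI ballI impI)
    fix N :: "'a measure" assume N: "N \<in> borel_probs" and "prokhorov_dist M N < 1 / real (Suc n)"
    then obtain d where d: "0 < d" "d < 1 / real (Suc n)"
      and le: "\<And>A. A \<in> sets borel \<Longrightarrow> measure M A \<le> measure N (eps_nbhd A d) + d"
      using prokhorov_dist_lessD[OF M] by blast
    interpret N: prob_space N using N by (simp add: borel_probs_def)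
    have "eps_nbhd (F n) d \<subseteq> U"
      unfolding eps_nbhd_def F_def using subset_ball[OF less_imp_le[OF d(2)]] by blast
    then have "measure N (eps_nbhd (F n) d) \<le> measure N U"
      using N assms by (intro N.finite_measure_mono) (auto simp: borel_probs_def)
    with le[of "F n"] Fcl[of n] n d N show "N \<in> {M \<in> borel_probs. a < measure M U}" by auto
  qed simp
qed blast

text \<open>A coupling bound: outside an event of probability at most \<open>e\<close>,
  \<open>X \<omega> \<in> A\<close> forces \<open>Y \<omega>\<close> into the
  \<open>e\<close>-neighbourhood of \<open>A\<close>. It is how all later Prokhorov estimates are
  obtained.\<close>

lemma prokhorov_dist_distr_le:
  fixes X Y :: "'b \<Rightarrow> 'a::{real_normed_vector, second_countable_topology}"
  assumes "prob_space P" and [measurable]: "X \<in> borel_measurable P" "Y \<in> borel_measurable P"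
    and "e > 0" and small: "measure P {\<omega> \<in> space P. norm (X \<omega> - Y \<omega>) \<ge> e} \<le> e"
  shows "prokhorov_dist (distr P borel X) (distr P borel Y) \<le> e"
proof -
  interpret prob_space P by fact
  have *: "measure (distr P borel X) A \<le> measure (distr P borel Y) (eps_nbhd A e) + e"
    if [measurable]: "A \<in> sets borel" "X \<in> borel_measurable P" "Y \<in> borel_measurable P"
      and s: "measure P {\<omega> \<in> space P. norm (X \<omega> - Y \<omega>) \<ge> e} \<le> e"
    for A :: "'a set" and X Y :: "'b \<Rightarrow> 'a"
  proof -
    have [measurable]: "eps_nbhd A e \<in> sets borel"
      unfolding eps_nbhd_def by (intro borel_open) auto
    have "Y \<omega> \<in> eps_nbhd A e" if "X \<omega> \<in> A" "norm (X \<omega> - Y \<omega>) < e" for \<omega>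
      using that unfolding eps_nbhd_def by (auto simp: dist_norm)
    then have sub: "X -` A \<inter> space P
        \<subseteq> (Y -` eps_nbhd A e \<inter> space P) \<union> {\<omega> \<in> space P. norm (X \<omega> - Y \<omega>) \<ge> e}"
      by (auto simp: not_le[symmetric])
    have "measure P (X -` A \<inter> space P)
        \<le> measure P ((Y -` eps_nbhd A e \<inter> space P) \<union> {\<omega> \<in> space P. norm (X \<omega> - Y \<omega>) \<ge> e})"
      by (intro finite_measure_mono sub) measurable
    also have "\<dots> \<le> measure P (Y -` eps_nbhd A e \<inter> space P)
        + measure P {\<omega> \<in> space P. norm (X \<omega> - Y \<omega>) \<ge> e}"
      by (intro measure_Un_le) auto
    finally show ?thesis using s by (simp add: measure_distr)
  qed
  show ?thesis
    using assms by (intro prokhorov_dist_leI *) (auto simp: norm_minus_commute)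
qed

lemma prokhorov_closure_ofI:
  assumes "m \<in> borel_probs"
    and "\<And>e. e > 0 \<Longrightarrow> \<exists>N\<in>S \<inter> borel_probs. prokhorov_dist m N < e"
  shows "m \<in> prokhorov_topology closure_of S"
  unfolding in_closure_of topspace_prokhorov
proof (intro conjI allI impI)
  fix U assume "m \<in> U \<and> openin prokhorov_topology U"
  then obtain e where "e > 0" "\<forall>N\<in>borel_probs. prokhorov_dist m N < e \<longrightarrow> N \<in> U"
    unfolding openin_prokhorov by blast
  then show "\<exists>y. y \<in> S \<and> y \<in> U" using assms(2)[of e] by blast
qed fact

text \<open>With a countable basis, \<open>HC T\<close> is a countable intersection of open sets
  \<open>O' V\<close>. Full mass on it means full mass on each \<open>O' V\<close>, that is, mass
  above \<open>1 - 1 / real (Suc n)\<close> for every \<open>n\<close>; each of these conditions is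
  open by lower semicontinuity.\<close>

lemma gdelta_prokhorov_HC:
  fixes T :: "'a::{metric_space, second_countable_topology} \<Rightarrow> 'a"
  assumes "continuous_on UNIV T" and S: "S \<subseteq> borel_probs"
  shows "HC T \<in> sets borel"
    and "gdelta_in (subtopology prokhorov_topology S) {m \<in> S. emeasure m (HC T) = 1}"
proof -
  obtain B :: "'a set set" where B: "countable B" "topological_basis B"
    using ex_countable_basis by blast
  define O' where "O' V = (\<Union>n. (T ^^ n) -` V)" for V
  have cont: "continuous_on UNIV (T ^^ n)" for n
    by (induction n) (auto intro!: continuous_on_compose2[OF assms(1)] simp: o_def)
  have opn: "open (O' V)" if "V \<in> B" for V
    unfolding O'_def using topological_basis_open[OF B(2) that] cont
    by (auto intro!: open_vimage)
  have HC: "HC T = (\<Inter>V\<in>B - {{}}. O' V)"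
  proof (rule set_eqI)
    fix x
    have "x \<in> HC T \<longleftrightarrow> (\<forall>V. open V \<and> V \<noteq> {} \<longrightarrow> V \<inter> range (\<lambda>n. (T ^^ n) x) \<noteq> {})"
    proof
      assume "x \<in> HC T"
      then have "closure (range (\<lambda>n. (T ^^ n) x)) = UNIV" by (simp add: HC_def)
      then show "\<forall>V. open V \<and> V \<noteq> {} \<longrightarrow> V \<inter> range (\<lambda>n. (T ^^ n) x) \<noteq> {}"
        by (metis open_Int_closure_eq_empty Int_UNIV_right)
    next
      assume *: "\<forall>V. open V \<and> V \<noteq> {} \<longrightarrow> V \<inter> range (\<lambda>n. (T ^^ n) x) \<noteq> {}"
      have "- closure (range (\<lambda>n. (T ^^ n) x)) \<inter> range (\<lambda>n. (T ^^ n) x) = {}"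
        using closure_subset[of "range (\<lambda>n. (T ^^ n) x)"] by blast
      with *[rule_format, of "- closure (range (\<lambda>n. (T ^^ n) x))"]
      have "- closure (range (\<lambda>n. (T ^^ n) x)) = {}"
        using open_Compl[OF closed_closure] by (auto simp only:)
      then show "x \<in> HC T" unfolding HC_def by blast
    qed
    also have "\<dots> \<longleftrightarrow> (\<forall>V\<in>B - {{}}. V \<inter> range (\<lambda>n. (T ^^ n) x) \<noteq> {})"
    proof (intro iffI allI impI)
      fix V :: "'a set"
      assume hit: "\<forall>V\<in>B - {{}}. V \<inter> range (\<lambda>n. (T ^^ n) x) \<noteq> {}" and V: "open V \<and> V \<noteq> {}"
      from V obtain v where "v \<in> V" by blast
      with V B(2) obtain W where "W \<in> B" "v \<in> W" "W \<subseteq> V" by (meson topological_basisE)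
      with hit show "V \<inter> range (\<lambda>n. (T ^^ n) x) \<noteq> {}" by blast
    qed (use topological_basis_open[OF B(2)] in blast)
    also have "\<dots> \<longleftrightarrow> x \<in> (\<Inter>V\<in>B - {{}}. O' V)" unfolding O'_def by (auto simp: disjoint_iff)
    finally show "x \<in> HC T \<longleftrightarrow> x \<in> (\<Inter>V\<in>B - {{}}. O' V)" .
  qed
  show HCb: "HC T \<in> sets borel"
    unfolding HC by (rule sets.countable_INT'') (use B opn in auto)
  define G where "G = (\<lambda>(V, n::nat). S \<inter> {m \<in> borel_probs. measure m (O' V) > 1 - 1 / real (Suc n)})"
  \<comment> \<open>Adjoining \<open>S\<close>, the whole space of the subtopology, makes the family
    visibly nonempty and confines the intersection to \<open>S\<close>.\<close>
  have eq: "{m \<in> S. emeasure m (HC T) = 1} = \<Inter> (insert S (G ` ((B - {{}}) \<times> UNIV)))"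
  proof (rule set_eqI)
    fix m
    show "m \<in> {m \<in> S. emeasure m (HC T) = 1} \<longleftrightarrow> m \<in> \<Inter> (insert S (G ` ((B - {{}}) \<times> UNIV)))"
    proof (cases "m \<in> S")
      case True
      then have mb: "m \<in> borel_probs" and sm: "sets m = sets borel" using S by (auto simp: borel_probs_def)
      then interpret prob_space m by (simp add: borel_probs_def)
      have ms: "O' V \<in> sets m" if "V \<in> B" for V using opn[OF that] sm by auto
      have "emeasure m (HC T) = 1 \<longleftrightarrow> (AE x in m. x \<in> HC T)"
        using HCb sm prob_eq_1[of "HC T"] by (simp add: emeasure_eq_measure)
      also have "\<dots> \<longleftrightarrow> (\<forall>V\<in>B - {{}}. AE x in m. x \<in> O' V)"
        unfolding HC using B(1) by (simp add: AE_ball_countable)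
      also have "\<dots> \<longleftrightarrow> (\<forall>V\<in>B - {{}}. measure m (O' V) = 1)"
        using ms by (auto simp: prob_eq_1)
      also have "\<dots> \<longleftrightarrow> (\<forall>V\<in>B - {{}}. \<forall>n. measure m (O' V) > 1 - 1 / real (Suc n))"
      proof (intro ball_cong refl iffI allI)
        fix V assume *: "\<forall>n. measure m (O' V) > 1 - 1 / real (Suc n)"
        have "measure m (O' V) \<ge> 1"
        proof (rule ccontr)
          assume "\<not> measure m (O' V) \<ge> 1"
          then obtain n where "1 / real (Suc n) < 1 - measure m (O' V)"
            using nat_approx_posE[of "1 - measure m (O' V)"] by auto
          with *[rule_format, of n] show False by linarith
        qed
        then show "measure m (O' V) = 1" using prob_le_1[of "O' V"] by linarith
      qed simp
      also have "\<dots> \<longleftrightarrow> m \<in> \<Inter> (insert S (G ` ((B - {{}}) \<times> UNIV)))"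
        using True mb by (auto simp: G_def)
      finally show ?thesis using True by simp
    qed auto
  qed
  have top: "topspace (subtopology prokhorov_topology S) = S"
    using S by (auto simp: topspace_prokhorov)
  show "gdelta_in (subtopology prokhorov_topology S) {m \<in> S. emeasure m (HC T) = 1}"
    unfolding eq
  proof (rule gdelta_in_Inter)
    show "countable (insert S (G ` ((B - {{}}) \<times> UNIV)))" using B(1) by auto
    fix R assume "R \<in> insert S (G ` ((B - {{}}) \<times> UNIV))"
    then consider "R = S" | V n where "V \<in> B" "R = G (V, n)" by auto
    then show "gdelta_in (subtopology prokhorov_topology S) R"
    proof cases
      case 1 then show ?thesis using gdelta_in_topspace top by metis
    next
      case 2
      then show ?thesis
        using openin_prokhorov_measure_gt[OF opn] unfolding G_def
        by (auto intro!: open_imp_gdelta_in openin_subtopology_Int2)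
    qed
  qed blast
qed

section \<open>Independent eigenvalues and Kronecker approximation\<close>

text \<open>For disjoint \<open>J\<close> and \<open>K\<close> this is independence of the
  \<open>lam k\<close> modulo the multiplicative group generated by the \<open>lam j\<close>:
  relations inside \<open>J\<close> are allowed. For empty \<open>J\<close> it is
  \<open>independent_family\<close>.\<close>

definition independent_over :: "'k set \<Rightarrow> 'k set \<Rightarrow> ('k \<Rightarrow> complex) \<Rightarrow> bool" where
  "independent_over J K lam \<longleftrightarrow>
     (\<forall>m::'k \<Rightarrow> int. (\<Prod>i\<in>J \<union> K. lam i powi m i) = 1 \<longrightarrow> (\<forall>k\<in>K. m k = 0))"

lemma prod_powi:
  fixes f :: "'k \<Rightarrow> 'a::field"
  shows "(\<Prod>i\<in>A. f i powi n) = (\<Prod>i\<in>A. f i) powi n"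
  by (induction A rule: infinite_finite_induct) (auto simp: power_int_mult_distrib)

text \<open>An exchange argument: if enlarging \<open>J\<close> by \<open>j\<close> creates a
  relation \<open>m\<close> involving some \<open>k0\<close> in \<open>K\<close>, then deleting
  \<open>k0\<close> suffices, because any further relation avoiding \<open>k0\<close> can be
  combined with \<open>m\<close> so as to eliminate \<open>j\<close>.\<close>

lemma independent_over_exchange:
  fixes lam :: "'k \<Rightarrow> complex"
  assumes fin: "finite J" "finite K" and disj: "J \<inter> K = {}" and j: "j \<notin> J \<union> K"
    and nz: "\<And>i. i \<in> insert j (J \<union> K) \<Longrightarrow> lam i \<noteq> 0"
    and ind: "independent_over J K lam"
  shows "\<exists>K'\<subseteq>K. card (K - K') \<le> 1 \<and> independent_over (insert j J) K' lam"
proof (cases "independent_over (insert j J) K lam")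
  case True
  then show ?thesis by (intro exI[of _ K]) auto
next
  case False
  then obtain m k0 where m: "(\<Prod>i\<in>insert j (J \<union> K). lam i powi m i) = 1" and k0: "k0 \<in> K" "m k0 \<noteq> 0"
    unfolding independent_over_def by auto
  have "independent_over (insert j J) (K - {k0}) lam"
    unfolding independent_over_def
  proof (intro allI impI)
    fix m0 :: "'k \<Rightarrow> int" assume m0: "(\<Prod>i\<in>insert j J \<union> (K - {k0}). lam i powi m0 i) = 1"
    \<comment> \<open>Exponent 0 at \<open>k0\<close> puts both relations on the same index
      set.\<close>
    define m' where "m' = m0 (k0 := 0)"
    have n: "k0 \<notin> insert j J \<union> (K - {k0})"
      and eq: "insert j (J \<union> K) = insert k0 (insert j J \<union> (K - {k0}))" using j k0 disj by auto
    have "(\<Prod>i\<in>insert j (J \<union> K). lam i powi m' i)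
        = lam k0 powi m' k0 * (\<Prod>i\<in>insert j J \<union> (K - {k0}). lam i powi m' i)"
      unfolding eq using fin n by (intro prod.insert) auto
    also have "(\<Prod>i\<in>insert j J \<union> (K - {k0}). lam i powi m' i) = 1"
      unfolding m0[symmetric] using n by (intro prod.cong) (auto simp: m'_def)
    finally have m': "(\<Prod>i\<in>insert j (J \<union> K). lam i powi m' i) = 1" by (simp add: m'_def)
    \<comment> \<open>The exponent vanishes at \<open>j\<close>, so this is a relation over
      \<open>J \<union> K\<close>. Its exponent at \<open>k0\<close> is
      \<open>- m' j * m k0\<close>, which independence over \<open>J\<close> makes zero; hence
      \<open>m' j = 0\<close>, and \<open>m'\<close> is itself a relation over
      \<open>J \<union> K\<close>.\<close>
    have "(\<Prod>i\<in>insert j (J \<union> K). lam i powi (m j * m' i - m' j * m i))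
        = (\<Prod>i\<in>insert j (J \<union> K). (lam i powi m' i) powi m j / (lam i powi m i) powi m' j)"
      using nz by (intro prod.cong) (auto simp: power_int_diff mult.commute simp flip: power_int_mult)
    also have "\<dots> = (\<Prod>i\<in>insert j (J \<union> K). lam i powi m' i) powi m j
        / (\<Prod>i\<in>insert j (J \<union> K). lam i powi m i) powi m' j"
      by (simp only: prod_dividef prod_powi)
    also have "\<dots> = 1" using m m' by simp
    finally have "(\<Prod>i\<in>J \<union> K. lam i powi (m j * m' i - m' j * m i)) = 1"
      using fin j by simp
    then have "m j * m' k0 - m' j * m k0 = 0"
      using ind[unfolded independent_over_def, rule_format, of "\<lambda>i. m j * m' i - m' j * m i"] k0(1) by blast
    then have "m' j = 0" using k0(2) by (simp add: m'_def)
    with m' have "(\<Prod>i\<in>J \<union> K. lam i powi m' i) = 1" using fin j by simp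
    with ind have z: "\<forall>k\<in>K. m' k = 0" unfolding independent_over_def by blast
    show "\<forall>k\<in>K - {k0}. m0 k = 0"
    proof
      fix k assume "k \<in> K - {k0}"
      then show "m0 k = 0" using bspec[OF z, of k] by (simp add: m'_def)
    qed
  qed
  then show ?thesis using k0 fin by (intro exI[of _ "K - {k0}"]) (auto simp: double_diff)
qed

text \<open>Starting from the empty family, each element of \<open>J\<close> is added by one
  exchange and costs at most one element of \<open>K\<close>.\<close>

lemma independent_over_subfamily:
  fixes lam :: "'k \<Rightarrow> complex"
  assumes "finite J" "finite K" "J \<inter> K = {}" "\<And>i. i \<in> J \<union> K \<Longrightarrow> lam i \<noteq> 0"
    and "independent_family K lam"
  shows "\<exists>K'\<subseteq>K. card (K - K') \<le> card J \<and> independent_over J K' lam"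
  using assms
proof (induction J rule: finite_induct)
  case empty
  then show ?case
    by (intro exI[of _ K]) (auto simp: independent_over_def independent_family_def)
next
  case (insert j J)
  then obtain K1 where K1: "K1 \<subseteq> K" "card (K - K1) \<le> card J" "independent_over J K1 lam" by auto
  have "finite K1" using K1(1) insert.prems(1) finite_subset by blast
  moreover have "J \<inter> K1 = {}" "j \<notin> J \<union> K1" "\<And>i. i \<in> insert j (J \<union> K1) \<Longrightarrow> lam i \<noteq> 0"
    using insert.prems insert.hyps K1(1) by auto
  ultimately obtain K2 where K2: "K2 \<subseteq> K1" "card (K1 - K2) \<le> 1" "independent_over (insert j J) K2 lam"
    using independent_over_exchange[OF insert.hyps(1) _ _ _ _ K1(3)] by blast
  have "card (K - K2) \<le> card ((K - K1) \<union> (K1 - K2))"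
    using insert.prems(1) \<open>finite K1\<close> by (intro card_mono) auto
  also have "\<dots> \<le> card (K - K1) + card (K1 - K2)" by (rule card_Un_le)
  also have "\<dots> \<le> card (insert j J)" using K1(2) K2(2) insert.hyps by simp
  finally show ?case using K1(1) K2 by blast
qed

section \<open>Kronecker approximation by a nonnegative trigonometric kernel\<close>

lemma cesaro_mean_unimodular_powers:
  assumes "cmod \<mu> = 1"
  shows "(\<lambda>N. (\<Sum>n<N. \<mu> ^ n) / of_nat N) \<longlonglongrightarrow> (if \<mu> = 1 then 1 else 0)"
proof (cases "\<mu> = 1")
  case True
  have "(\<lambda>N. (\<Sum>n<N. \<mu> ^ n) / of_nat N :: complex) \<longlonglongrightarrow> 1"
  proof (rule tendsto_eventually)
    show "\<forall>\<^sub>F N in sequentially. (\<Sum>n<N. \<mu> ^ n) / of_nat N = (1::complex)"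
      using eventually_gt_at_top[of 0] by eventually_elim (simp add: True)
  qed
  then show ?thesis using True by simp
next
  case False
  have "(\<lambda>N. (\<Sum>n<N. \<mu> ^ n) / of_nat N) \<longlonglongrightarrow> 0"
  proof (rule Lim_null_comparison)
    show "(\<lambda>N. 2 / cmod (1 - \<mu>) * (1 / real N)) \<longlonglongrightarrow> 0"
      by (intro tendsto_mult_right_zero lim_1_over_n)
    show "\<forall>\<^sub>F N in sequentially. norm ((\<Sum>n<N. \<mu> ^ n) / of_nat N) \<le> 2 / cmod (1 - \<mu>) * (1 / real N)"
    proof (rule always_eventually, rule allI)
      fix N
      have "cmod (1 - \<mu> ^ N) \<le> 2"
        using norm_triangle_ineq4[of 1 "\<mu> ^ N"] assms by (simp add: norm_power)
      then have "cmod ((1 - \<mu> ^ N) / (1 - \<mu>)) \<le> 2 / cmod (1 - \<mu>)"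
        by (simp add: norm_divide divide_right_mono)
      moreover have "(\<Sum>n<N. \<mu> ^ n) = (1 - \<mu> ^ N) / (1 - \<mu>)"
        using False by (simp add: sum_gp_strict)
      ultimately have "norm (\<Sum>n<N. \<mu> ^ n) \<le> 2 / cmod (1 - \<mu>)" by simp
      then have "norm (\<Sum>n<N. \<mu> ^ n) / real N \<le> 2 / cmod (1 - \<mu>) / real N"
        by (rule divide_right_mono) simp
      then show "norm ((\<Sum>n<N. \<mu> ^ n) / of_nat N) \<le> 2 / cmod (1 - \<mu>) * (1 / real N)"
        by (simp add: norm_divide)
    qed
  qed
  then show ?thesis using False by simp
qed

text \<open>On the unit circle \<open>cmod (1 + z) ^ 2 = (1 + z) ^ 2 / z\<close>, so the binomial
  theorem gives a trigonometric polynomial with positive coefficients. The index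
  \<open>a = M\<close> is its constant term. The function peaks at \<open>z = 1\<close>, which makes
  it a localizing kernel.\<close>

lemma cmod_one_plus_power_expansion:
  assumes "cmod z = 1"
  shows "complex_of_real (cmod (1 + z) ^ (2 * M))
    = (\<Sum>a\<le>2 * M. of_nat (2 * M choose a) * z powi (int a - int M))"
proof -
  have nz: "z \<noteq> 0" using assms by auto
  have zc: "z * cnj z = 1" using assms complex_norm_square[of z] by simp
  have "complex_of_real (cmod (1 + z) ^ 2) = (1 + z) * cnj (1 + z)"
    using complex_norm_square[of "1 + z"] by simp
  then have "complex_of_real (cmod (1 + z) ^ 2) * z = (1 + z) * (z + z * cnj z)"
    by (simp add: algebra_simps)
  also have "\<dots> = (1 + z) ^ 2" unfolding zc by (simp add: power2_eq_square add.commute)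
  finally have "complex_of_real (cmod (1 + z) ^ 2) * z = (1 + z) ^ 2" .
  then have "complex_of_real (cmod (1 + z) ^ (2 * M)) * z ^ M = (1 + z) ^ (2 * M)"
    by (metis of_real_power power_mult power_mult_distrib)
  also have "\<dots> = (\<Sum>a\<le>2 * M. of_nat (2 * M choose a) * z ^ a)"
    using binomial_ring[of z 1 "2 * M"] by (simp add: add.commute)
  finally have "complex_of_real (cmod (1 + z) ^ (2 * M))
      = (\<Sum>a\<le>2 * M. of_nat (2 * M choose a) * z ^ a) / z ^ M"
    using nz by (simp add: field_simps)
  also have "\<dots> = (\<Sum>a\<le>2 * M. of_nat (2 * M choose a) * z powi (int a - int M))"
    using nz by (simp add: sum_divide_distrib power_int_diff)
  finally show ?thesis .
qed

text \<open>The mean over \<open>n\<close> of the kernel below only sees the characters that are trivial on the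
  sequence \<open>n \<mapsto> (lam i ^ n)\<close>; by independence these do not involve \<open>\<theta>\<close>, so the mean is at least
  the constant coefficient.\<close>
lemma central_binomial_le_kernel_bound:
  fixes lam \<theta> :: "'k \<Rightarrow> complex"
  assumes fin: "finite J" "finite K"
    and lam: "\<And>i. i \<in> J \<union> K \<Longrightarrow> cmod (lam i) = 1"
    and \<theta>: "\<And>i. i \<in> J \<union> K \<Longrightarrow> cmod (\<theta> i) = 1" "\<And>j. j \<in> J - K \<Longrightarrow> \<theta> j = 1"
    and ind: "independent_over J K lam"
    and B: "\<And>n. (\<Prod>i\<in>J \<union> K. cmod (1 + cnj (\<theta> i) * lam i ^ n) ^ (2 * M)) \<le> B"
  shows "real (2 * M choose M) ^ card (J \<union> K) \<le> B"
proof -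
  define I where "I = J \<union> K"
  define A where "A = PiE I (\<lambda>_. {..2 * M})"
  define c where "c a = (\<Prod>i\<in>I. real (2 * M choose a i))" for a :: "'k \<Rightarrow> nat"
  \<comment> \<open>A multi-index \<open>a\<close> stands for the character with exponents
    \<open>a i - M\<close>; \<open>w a\<close> is its phase from the target, \<open>\<mu> a\<close>
    its value at \<open>lam\<close>, and \<open>c a\<close> its coefficient.\<close>
  define w where "w a = (\<Prod>i\<in>I. cnj (\<theta> i) powi (int (a i) - int M))" for a :: "'k \<Rightarrow> nat"
  define \<mu> where "\<mu> a = (\<Prod>i\<in>I. lam i powi (int (a i) - int M))" for a :: "'k \<Rightarrow> nat"
  define f where "f n = (\<Prod>i\<in>I. cmod (1 + cnj (\<theta> i) * lam i ^ n) ^ (2 * M))" for n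
  have finI: "finite I" and finA: "finite A" using fin by (auto simp: I_def A_def intro!: finite_PiE)
  have f: "complex_of_real (f n) = (\<Sum>a\<in>A. of_real (c a) * w a * \<mu> a ^ n)" for n
  proof -
    have "complex_of_real (f n) = (\<Prod>i\<in>I. \<Sum>a\<le>2 * M. of_nat (2 * M choose a)
        * (cnj (\<theta> i) * lam i ^ n) powi (int a - int M))"
      unfolding f_def of_real_prod using lam \<theta>
      by (intro prod.cong cmod_one_plus_power_expansion) (auto simp: I_def norm_mult norm_power)
    also have "\<dots> = (\<Sum>a\<in>A. \<Prod>i\<in>I. of_nat (2 * M choose a i)
        * (cnj (\<theta> i) * lam i ^ n) powi (int (a i) - int M))"
      unfolding A_def using finI by (intro prod_sum_PiE) auto
    also have "\<dots> = (\<Sum>a\<in>A. of_real (c a) * w a * \<mu> a ^ n)"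
    proof (rule sum.cong[OF refl])
      fix a
      have "(lam i ^ n) powi k = (lam i powi k) ^ n" for i k
        by (metis mult.commute power_int_mult power_int_of_nat)
      then show "(\<Prod>i\<in>I. of_nat (2 * M choose a i)
          * (cnj (\<theta> i) * lam i ^ n) powi (int (a i) - int M)) = of_real (c a) * w a * \<mu> a ^ n"
        by (simp add: c_def w_def \<mu>_def prod.distrib power_int_mult_distrib prod_power_distrib mult.assoc)
    qed
    finally show ?thesis .
  qed
  \<comment> \<open>A character trivial at \<open>lam\<close> is a multiplicative relation, so its
    exponents on \<open>K\<close> vanish; on \<open>J - K\<close> the target is 1. Hence the
    surviving coefficients are the nonnegative \<open>c a\<close>, free of phases.\<close>
  have w1: "w a = 1" if "\<mu> a = 1" for a
  proof -
    have "int (a k) - int M = 0" if "k \<in> K" for k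
      using ind \<open>\<mu> a = 1\<close> that unfolding independent_over_def \<mu>_def I_def by fast
    then have "cnj (\<theta> i) powi (int (a i) - int M) = 1" if "i \<in> I" for i
      using that \<theta>(2)[of i] by (cases "i \<in> K") (auto simp: I_def)
    then show ?thesis unfolding w_def by (intro prod.neutral) auto
  qed
  have "(\<lambda>N. \<Sum>a\<in>A. of_real (c a) * w a * ((\<Sum>n<N. \<mu> a ^ n) / of_nat N))
      \<longlonglongrightarrow> (\<Sum>a\<in>A. of_real (c a) * w a * (if \<mu> a = 1 then 1 else 0))"
    using lam by (intro tendsto_sum tendsto_mult tendsto_const cesaro_mean_unimodular_powers)
      (auto simp: \<mu>_def I_def prod_norm[symmetric] norm_power_int intro!: prod.neutral)
  also have "(\<Sum>a\<in>A. of_real (c a) * w a * (if \<mu> a = 1 then 1 else 0))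
      = complex_of_real (\<Sum>a\<in>A. if \<mu> a = 1 then c a else 0)"
    unfolding of_real_sum by (intro sum.cong) (auto simp: w1)
  also have "(\<lambda>N. \<Sum>a\<in>A. of_real (c a) * w a * ((\<Sum>n<N. \<mu> a ^ n) / of_nat N))
      = (\<lambda>N. complex_of_real ((\<Sum>n<N. f n) / real N))"
    by (rule ext) (simp add: f sum_divide_distrib sum_distrib_left sum.swap[of _ "{..<_}"])
  finally have lim: "(\<lambda>N. (\<Sum>n<N. f n) / real N) \<longlonglongrightarrow> (\<Sum>a\<in>A. if \<mu> a = 1 then c a else 0)"
    by (simp only: tendsto_of_real_iff)
  have "(\<Sum>a\<in>A. if \<mu> a = 1 then c a else 0) \<le> B"
  proof (rule LIMSEQ_le_const2[OF lim], intro exI[of _ 1] allI impI)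
    fix N :: nat assume "N \<ge> 1"
    have "(\<Sum>n<N. f n) \<le> of_nat (card {..<N}) * B"
      using B by (intro sum_bounded_above) (auto simp: f_def I_def)
    then show "(\<Sum>n<N. f n) / real N \<le> B" using \<open>N \<ge> 1\<close> by (simp add: field_simps)
  qed
  \<comment> \<open>The constant multi-index \<open>M\<close> is the trivial character, so it always
    survives; the other surviving terms can only increase the sum.\<close>
  moreover have "c (\<lambda>i\<in>I. M) \<le> (\<Sum>a\<in>A. if \<mu> a = 1 then c a else 0)"
  proof -
    have "\<mu> (\<lambda>i\<in>I. M) = 1" by (simp add: \<mu>_def)
    moreover have "(\<lambda>i\<in>I. M) \<in> A" by (auto simp: A_def)
    moreover have "c a \<ge> 0" for a by (auto simp: c_def intro!: prod_nonneg)
    ultimately show ?thesis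
      using member_le_sum[of "\<lambda>i\<in>I. M" A "\<lambda>a. if \<mu> a = 1 then c a else 0"] finA by auto
  qed
  moreover have "c (\<lambda>i\<in>I. M) = real (2 * M choose M) ^ card I" by (simp add: c_def)
  ultimately show ?thesis by (simp add: I_def)
qed

text \<open>If every time \<open>n\<close> missed some coordinate by \<open>\<epsilon>\<close>, the
  kernel centred at \<open>\<theta>\<close> would always lose a factor \<open>q ^ M\<close> with
  \<open>q < 1\<close> against its maximum \<open>4 ^ M\<close> per coordinate. Its mean is at least
  a power of the central binomial coefficient, which loses only a polynomial factor in
  \<open>M\<close>; large \<open>M\<close> is contradictory.\<close>

lemma kronecker_unimodular:
  fixes lam \<theta> :: "'k \<Rightarrow> complex"
  assumes fin: "finite J" "finite K"
    and lam: "\<And>i. i \<in> J \<union> K \<Longrightarrow> cmod (lam i) = 1"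
    and \<theta>: "\<And>i. i \<in> J \<union> K \<Longrightarrow> cmod (\<theta> i) = 1" "\<And>j. j \<in> J - K \<Longrightarrow> \<theta> j = 1"
    and ind: "independent_over J K lam" and "\<epsilon> > 0"
  shows "\<exists>n. \<forall>i\<in>J \<union> K. cmod (lam i ^ n - \<theta> i) < \<epsilon>"
proof (rule ccontr)
  assume neg: "\<not> ?thesis"
  define I where "I = J \<union> K"
  define r where "r = card I"
  \<comment> \<open>By the parallelogram identity \<open>par\<close>, distance at least
    \<open>\<epsilon>\<close> between \<open>z\<close> and 1 gives \<open>cmod (1 + z) ^ 2\<close>
    at most \<open>4 - \<epsilon> ^ 2\<close>, which is \<open>4 * q\<close>.\<close>
  define q where "q = 1 - (\<epsilon> / 2)\<^sup>2"
  have finI: "finite I" using fin by (simp add: I_def)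
  have ex: "\<exists>i\<in>I. cmod (lam i ^ n - \<theta> i) \<ge> \<epsilon>" for n
    using neg unfolding I_def by (metis not_le)
  then have "r > 0" using finI by (auto simp: r_def card_gt_0_iff)
  have dist: "cmod (1 - cnj (\<theta> i) * lam i ^ n) = cmod (lam i ^ n - \<theta> i)" if "i \<in> I" for i n
  proof -
    have "\<theta> i * cnj (\<theta> i) = 1" using \<theta>(1) that complex_norm_square[of "\<theta> i"] by (simp add: I_def)
    then have "\<theta> i * (1 - cnj (\<theta> i) * lam i ^ n) = \<theta> i - lam i ^ n"
      by (simp add: algebra_simps)
    then have "cmod (\<theta> i) * cmod (1 - cnj (\<theta> i) * lam i ^ n) = cmod (\<theta> i - lam i ^ n)"
      by (metis norm_mult)
    then show ?thesis using \<theta>(1) that by (simp add: I_def norm_minus_commute)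
  qed
  have par: "cmod (1 + z) ^ 2 = 4 - cmod (1 - z) ^ 2" if "cmod z = 1" for z
  proof -
    have "(Re z)\<^sup>2 + (Im z)\<^sup>2 = 1" using that cmod_power2[of z] by simp
    then show ?thesis unfolding cmod_power2 by (simp add: power2_eq_square algebra_simps)
  qed
  have z1: "cmod (cnj (\<theta> i) * lam i ^ n) = 1" if "i \<in> I" for i n
    using \<theta>(1) lam that by (simp add: I_def norm_mult norm_power)
  have q: "0 \<le> q" "q < 1"
  proof -
    \<comment> \<open>The assumed failure at time 0 already forces
      \<open>\<epsilon> \<le> 2\<close>, hence \<open>q \<ge> 0\<close>.\<close>
    obtain i where i: "i \<in> I" "cmod (lam i ^ 0 - \<theta> i) \<ge> \<epsilon>" using ex by blast
    have "\<epsilon> \<le> 2" using i norm_triangle_ineq4[of 1 "\<theta> i"] \<theta>(1) by (auto simp: I_def)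
    then have "(\<epsilon> / 2)\<^sup>2 \<le> 1" using \<open>\<epsilon> > 0\<close> by (intro power_le_one) auto
    then show "0 \<le> q" by (simp add: q_def)
    show "q < 1" using \<open>\<epsilon> > 0\<close> by (simp add: q_def)
  qed
  have bound: "(\<Prod>i\<in>I. cmod (1 + cnj (\<theta> i) * lam i ^ n) ^ (2 * M)) \<le> (4 ^ M) ^ r * q ^ M" for n M
  proof -
    obtain i where i: "i \<in> I" "cmod (lam i ^ n - \<theta> i) \<ge> \<epsilon>" using ex by blast
    have le4: "cmod (1 + cnj (\<theta> i) * lam i ^ n) ^ (2 * M) \<le> 4 ^ M" if "i \<in> I" for i
      unfolding power_mult
    proof (rule power_mono)
      show "(cmod (1 + cnj (\<theta> i) * lam i ^ n))\<^sup>2 \<le> 4"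
        using par[OF z1[OF that, of n]] zero_le_power2[of "cmod (1 - cnj (\<theta> i) * lam i ^ n)"] by linarith
    qed simp
    have "cmod (1 + cnj (\<theta> i) * lam i ^ n) ^ 2 = 4 - cmod (lam i ^ n - \<theta> i) ^ 2"
      using par[OF z1[OF i(1)]] dist[OF i(1)] by simp
    also have "\<dots> \<le> 4 - \<epsilon> ^ 2" using i(2) \<open>\<epsilon> > 0\<close> by (simp add: power_mono)
    also have "\<dots> = 4 * q" by (simp add: q_def power_divide)
    finally have "cmod (1 + cnj (\<theta> i) * lam i ^ n) ^ (2 * M) \<le> (4 * q) ^ M"
      unfolding power_mult by (intro power_mono) auto
    moreover have "(\<Prod>i\<in>I - {i}. cmod (1 + cnj (\<theta> i) * lam i ^ n) ^ (2 * M)) \<le> (\<Prod>i\<in>I - {i}. 4 ^ M)"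
      using le4 by (intro prod_mono) auto
    ultimately have "(\<Prod>i\<in>I. cmod (1 + cnj (\<theta> i) * lam i ^ n) ^ (2 * M))
        \<le> (4 * q) ^ M * (4 ^ M) ^ (r - 1)"
      unfolding prod.remove[OF finI i(1)] using finI i(1) q(1)
      by (intro mult_mono) (auto simp: r_def intro!: prod_nonneg simp del: power_mult)
    also have "\<dots> = (4 ^ M) ^ r * q ^ M"
      using \<open>r > 0\<close> by (cases r) (auto simp: power_mult_distrib)
    finally show ?thesis .
  qed
  \<comment> \<open>Writing \<open>q ^ M\<close> as an \<open>r\<close>-th power gathers everything
    into one power, whose base tends to 0 because \<open>root r q < 1\<close>.\<close>
  have ge1: "1 \<le> (2 * (real M * root r q ^ M)) ^ r" if "M > 0" for M
  proof -
    have "(4 ^ M / (2 * real M)) ^ r \<le> real (2 * M choose M) ^ r"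
      using central_binomial_lower_bound[OF that] by (intro power_mono) auto
    also have "\<dots> \<le> (4 ^ M) ^ r * q ^ M"
      unfolding r_def I_def
      by (rule central_binomial_le_kernel_bound[OF fin lam \<theta> ind])
        (use bound in \<open>auto simp: I_def r_def\<close>)
    finally have "1 \<le> (2 * real M) ^ r * q ^ M"
      using that by (simp add: field_simps)
    also have "q ^ M = (root r q ^ M) ^ r"
      using \<open>r > 0\<close> q by (metis mult.commute power_mult real_root_pow_pos2)
    finally show ?thesis by (simp add: power_mult_distrib mult.assoc)
  qed
  have "(\<lambda>M. (2 * (real M * root r q ^ M)) ^ r) \<longlonglongrightarrow> (2 * 0) ^ r"
    using q \<open>r > 0\<close> by (intro tendsto_power tendsto_mult tendsto_const powser_times_n_limit_0)
      (simp add: real_root_ge_zero)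
  moreover have "(2 * 0 :: real) ^ r = 0" using \<open>r > 0\<close> by simp
  ultimately have "(\<lambda>M. (2 * (real M * root r q ^ M)) ^ r) \<longlonglongrightarrow> 0" by (simp only:)
  then have "\<forall>\<^sub>F M in sequentially. (2 * (real M * root r q ^ M)) ^ r < 1"
    by (rule order_tendstoD(2)) simp
  then have "\<forall>\<^sub>F M in sequentially. (2 * (real M * root r q ^ M)) ^ r < 1 \<and> M > 0"
    using eventually_gt_at_top[of 0] by (rule eventually_conj)
  then obtain M where "(2 * (real M * root r q ^ M)) ^ r < 1" "M > 0"
    using eventually_happens sequentially_bot by blast
  with ge1[of M] show False by linarith
qed

text \<open>A finite \<open>\<epsilon> / 2\<close>-net of the circle leaves finitely many target
  tuples on \<open>K\<close>, and the largest of their times serves every target. The bound must not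
  depend on the target because the later targets are random.\<close>

lemma kronecker_unimodular_uniform:
  fixes lam :: "'k \<Rightarrow> complex"
  assumes fin: "finite J" "finite K" and "J \<inter> K = {}"
    and lam: "\<And>i. i \<in> J \<union> K \<Longrightarrow> cmod (lam i) = 1"
    and ind: "independent_over J K lam" and "\<epsilon> > 0"
  shows "\<exists>N. \<forall>\<theta>. (\<forall>k\<in>K. cmod (\<theta> k) = 1) \<longrightarrow>
    (\<exists>n\<le>N. (\<forall>j\<in>J. cmod (lam j ^ n - 1) < \<epsilon>) \<and> (\<forall>k\<in>K. cmod (lam k ^ n - \<theta> k) < \<epsilon>))"
proof -
  obtain D where D: "finite D" "D \<subseteq> sphere 0 (1::real)" "sphere 0 1 \<subseteq> (\<Union>d\<in>D. ball (d::complex) (\<epsilon> / 2))"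
    using compactE_image[of "sphere 0 (1::real)" "sphere 0 1" "\<lambda>d::complex. ball d (\<epsilon> / 2)"] \<open>\<epsilon> > 0\<close>
    by force
  define P where "P \<theta> n \<longleftrightarrow> (\<forall>i\<in>J \<union> K. cmod (lam i ^ n - (if i \<in> J then 1 else \<theta> i)) < \<epsilon> / 2)" for \<theta> n
  have "\<exists>n. P \<theta> n" if "\<theta> \<in> PiE K (\<lambda>_. D)" for \<theta>
    unfolding P_def using fin lam ind \<open>\<epsilon> > 0\<close> D(2) that
    by (intro kronecker_unimodular) (auto simp: PiE_iff subset_eq)
  then obtain g where g: "P \<theta> (g \<theta>)" if "\<theta> \<in> PiE K (\<lambda>_. D)" for \<theta>
    by metis
  have finP: "finite (PiE K (\<lambda>_. D))" using fin D(1) by (intro finite_PiE) auto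
  show ?thesis
  proof (rule exI[of _ "Max (g ` PiE K (\<lambda>_. D))"], intro allI impI)
    fix \<theta> :: "'k \<Rightarrow> complex" assume \<theta>: "\<forall>k\<in>K. cmod (\<theta> k) = 1"
    have "\<exists>d\<in>D. cmod (\<theta> k - d) < \<epsilon> / 2" if "k \<in> K" for k
    proof -
      have "\<theta> k \<in> (\<Union>d\<in>D. ball d (\<epsilon> / 2))" using D(3) \<theta> that by (auto simp: subset_eq)
      then show ?thesis by (auto simp: dist_norm norm_minus_commute)
    qed
    then obtain h where h: "h k \<in> D" "cmod (\<theta> k - h k) < \<epsilon> / 2" if "k \<in> K" for k
      by metis
    define \<eta> where "\<eta> = restrict h K"
    have \<eta>: "\<eta> \<in> PiE K (\<lambda>_. D)" using h by (auto simp: \<eta>_def)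
    have le: "g \<eta> \<le> Max (g ` PiE K (\<lambda>_. D))" using finP \<eta> by auto
    have J: "cmod (lam j ^ g \<eta> - 1) < \<epsilon>" if "j \<in> J" for j
    proof -
      have "cmod (lam j ^ g \<eta> - 1) < \<epsilon> / 2"
        using bspec[OF g[OF \<eta>, unfolded P_def], of j] that by simp
      then show ?thesis using \<open>\<epsilon> > 0\<close> by linarith
    qed
    have K: "cmod (lam k ^ g \<eta> - \<theta> k) < \<epsilon>" if "k \<in> K" for k
    proof -
      have "k \<notin> J" using that assms(3) by blast
      then have "cmod (lam k ^ g \<eta> - h k) < \<epsilon> / 2"
        using bspec[OF g[OF \<eta>, unfolded P_def], of k] that by (simp add: \<eta>_def)
      then show ?thesis
        using h(2)[OF that] norm_triangle_ineq4[of "lam k ^ g \<eta> - h k" "\<theta> k - h k"] by simp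
    qed
    show "\<exists>n\<le>Max (g ` PiE K (\<lambda>_. D)). (\<forall>j\<in>J. cmod (lam j ^ n - 1) < \<epsilon>)
        \<and> (\<forall>k\<in>K. cmod (lam k ^ n - \<theta> k) < \<epsilon>)"
      using le J K by blast
  qed
qed

section \<open>Steinhaus sums and type\<close>

lemma borel_measurable_cis [measurable]: "cis \<in> borel_measurable borel"
  by (intro borel_measurable_continuous_onI continuous_intros)

lemma prob_space_circle_uniform: "prob_space circle_uniform"
proof -
  have "prob_space (uniform_measure lborel {0..2*pi})"
    by (rule prob_space_uniform_measure) (auto simp: emeasure_lborel_Icc_eq)
  then show ?thesis
    unfolding circle_uniform_def by (rule prob_space.prob_space_distr) measurable
qed

lemma sets_circle_uniform [simp, measurable_cong]: "sets circle_uniform = sets borel"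
  and space_circle_uniform [simp]: "space circle_uniform = UNIV"
  by (simp_all add: circle_uniform_def)

lemma AE_circle_uniform_cmod: "AE z in circle_uniform. cmod z = 1"
  unfolding circle_uniform_def by (subst AE_distr_iff) auto

lemma emeasure_circle_uniform:
  assumes [measurable]: "A \<in> sets borel"
  shows "emeasure circle_uniform A = emeasure lborel ({0..2*pi} \<inter> cis -` A) / emeasure lborel {0..2*pi}"
proof -
  have [measurable]: "cis -` A \<in> sets borel"
    using measurable_sets_borel[of cis borel A] by simp
  have "emeasure circle_uniform A = emeasure (uniform_measure lborel {0..2*pi}) (cis -` A)"
    unfolding circle_uniform_def by (subst emeasure_distr) auto
  then show ?thesis by (simp add: emeasure_uniform_measure)
qed

text \<open>Negation is a half-turn: it exchanges the angles in \<open>{0..<pi}\<close> and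
  \<open>{pi..<2*pi}\<close> by translation. This symmetry is what links Steinhaus variables to the
  Rademacher signs in the definition of type.\<close>

lemma distr_circle_uniform_uminus: "distr circle_uniform circle_uniform uminus = circle_uniform"
proof (rule measure_eqI)
  fix A assume "A \<in> sets (distr circle_uniform circle_uniform uminus)"
  then have A [measurable]: "A \<in> sets borel" by simp
  define E where "E = cis -` A"
  define E' where "E' = cis -` (uminus -` A)"
  have [measurable]: "uminus -` A \<in> sets borel"
    by (rule measurable_sets_borel[of _ borel]) measurable
  then have [measurable]: "E \<in> sets borel" "E' \<in> sets borel"
    unfolding E_def E'_def by (auto intro: measurable_sets_borel[of _ borel])
  have tr: "emeasure lborel B = emeasure lborel ((\<lambda>t. c + t) -` B)" if [measurable]: "B \<in> sets borel"
    for B and c :: real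
    by (subst lborel_distr_plus[of c, symmetric], subst emeasure_distr) auto
  \<comment> \<open>Half-open halves fit the translations by \<open>pi\<close>; the discarded
    endpoint \<open>2 * pi\<close> is a null set.\<close>
  have split: "emeasure lborel ({0..2*pi} \<inter> B)
      = emeasure lborel ({0..<pi} \<inter> B) + emeasure lborel ({pi..<2*pi} \<inter> B)"
    if [measurable]: "B \<in> sets borel" for B
  proof -
    have "emeasure lborel ({0..2*pi} \<inter> B) = emeasure lborel (({0..<pi} \<inter> B) \<union> ({pi..<2*pi} \<inter> B))"
    proof (rule emeasure_eq_AE)
      show "AE t in lborel. (t \<in> {0..2*pi} \<inter> B) = (t \<in> ({0..<pi} \<inter> B) \<union> ({pi..<2*pi} \<inter> B))"
        using AE_lborel_singleton[of "2 * pi"] by eventually_elim (use pi_ge_zero in \<open>auto simp del: pi_ge_zero\<close>)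
    qed auto
    then show ?thesis by (subst (asm) plus_emeasure[symmetric]) auto
  qed
  have shift: "cis (t - pi) = - cis t" "cis (pi + t) = - cis t" for t
    by (simp_all add: complex_eq_iff cos_diff sin_diff cos_add sin_add)
  have "emeasure lborel ({0..<pi} \<inter> E') = emeasure lborel ((\<lambda>t. - pi + t) -` ({0..<pi} \<inter> E'))"
    by (rule tr) simp
  also have "(\<lambda>t. - pi + t) -` ({0..<pi} \<inter> E') = {pi..<2*pi} \<inter> E"
    by (auto simp: E_def E'_def shift)
  finally have 1: "emeasure lborel ({0..<pi} \<inter> E') = emeasure lborel ({pi..<2*pi} \<inter> E)" .
  have "emeasure lborel ({pi..<2*pi} \<inter> E') = emeasure lborel ((\<lambda>t. pi + t) -` ({pi..<2*pi} \<inter> E'))"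
    by (rule tr) simp
  also have "(\<lambda>t. pi + t) -` ({pi..<2*pi} \<inter> E') = {0..<pi} \<inter> E"
    by (auto simp: E_def E'_def shift)
  finally have 2: "emeasure lborel ({pi..<2*pi} \<inter> E') = emeasure lborel ({0..<pi} \<inter> E)" .
  have "emeasure (distr circle_uniform circle_uniform uminus) A = emeasure circle_uniform (uminus -` A)"
    by (subst emeasure_distr) auto
  also have "\<dots> = emeasure circle_uniform A"
    unfolding emeasure_circle_uniform[OF A] emeasure_circle_uniform[OF \<open>uminus -` A \<in> sets borel\<close>]
      E_def[symmetric] E'_def[symmetric]
    by (simp add: split 1 2 add.commute)
  finally show "emeasure (distr circle_uniform circle_uniform uminus) A = emeasure circle_uniform A" .
qed simp

text \<open>A single infinite product carries the sums over all finite \<open>J\<close> at once, so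
  that successive sums can be subtracted pointwise and limits taken.\<close>

definition steinhaus_space :: "(nat \<Rightarrow> complex) measure" where
  "steinhaus_space = PiM UNIV (\<lambda>_. circle_uniform)"

definition steinhaus_sum :: "nat set \<Rightarrow> (nat \<Rightarrow> 'a::complex_normed_vector) \<Rightarrow> (nat \<Rightarrow> complex) \<Rightarrow> 'a" where
  "steinhaus_sum J x \<omega> = (\<Sum>j\<in>J. \<omega> j *\<^sub>C x j)"

lemma prob_space_steinhaus_space: "prob_space steinhaus_space"
  unfolding steinhaus_space_def by (intro prob_space_PiM prob_space_circle_uniform)

lemma sets_steinhaus_space [measurable_cong]:
  "sets steinhaus_space = sets (PiM UNIV (\<lambda>_. borel :: complex measure))"
  unfolding steinhaus_space_def by (intro sets_PiM_cong) auto

lemma space_steinhaus_space [simp]: "space steinhaus_space = UNIV"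
  by (simp add: steinhaus_space_def space_PiM)

text \<open>The coordinates range over all of \<open>complex\<close>, so unimodularity holds only
  almost everywhere; countably many coordinates share one null set.\<close>

lemma AE_steinhaus_space_cmod: "AE \<omega> in steinhaus_space. \<forall>k. cmod (\<omega> k) = 1"
  unfolding AE_all_countable steinhaus_space_def
  by (intro allI AE_PiM_component prob_space_circle_uniform AE_circle_uniform_cmod) auto

lemma scaleC_zero_right: "c *\<^sub>C (0::'a::complex_normed_vector) = 0"
  by (metis norm_eq_zero norm_scaleC mult_zero_right norm_zero)

lemma bounded_linear_scaleC_left: "bounded_linear (\<lambda>c. c *\<^sub>C (x::'a::complex_normed_vector))"
proof (rule bounded_linear_intro)
  fix r :: real and c :: complex
  show "(r *\<^sub>R c) *\<^sub>C x = r *\<^sub>R (c *\<^sub>C x)"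
    by (metis scaleC_of_real scaleC_scaleC scaleR_conv_of_real)
qed (auto simp: scaleC_add_left norm_scaleC mult.commute)

lemma measurable_scaleC_left [measurable (raw)]:
  fixes x :: "'a::complex_normed_vector"
  assumes "f \<in> borel_measurable M"
  shows "(\<lambda>\<omega>. f \<omega> *\<^sub>C x) \<in> borel_measurable M"
  using measurable_compose[OF assms borel_measurable_continuous_onI[OF
      linear_continuous_on[OF bounded_linear_scaleC_left]]] .

lemma measurable_steinhaus_sum [measurable]:
  fixes x :: "nat \<Rightarrow> 'a::{complex_normed_vector, second_countable_topology}"
  shows "steinhaus_sum J x \<in> borel_measurable steinhaus_space"
  unfolding steinhaus_sum_def by measurable

text \<open>The finite product is a marginal of the infinite one, so moving to the common space does
  not change Steinhaus measures.\<close>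

lemma distr_steinhaus_sum:
  fixes x :: "nat \<Rightarrow> 'a::{complex_normed_vector, second_countable_topology}"
  assumes "finite J"
  shows "distr (PiM J (\<lambda>_. circle_uniform)) borel (\<lambda>ch. \<Sum>j\<in>J. ch j *\<^sub>C x j)
    = distr steinhaus_space borel (steinhaus_sum J x)"
proof -
  interpret product_prob_space "\<lambda>_::nat. circle_uniform" UNIV
    by (simp add: product_prob_space_def product_prob_space_axioms_def product_sigma_finite_def
        prob_space_circle_uniform prob_space_imp_sigma_finite)
  have "distr (PiM J (\<lambda>_. circle_uniform)) borel (\<lambda>ch. \<Sum>j\<in>J. ch j *\<^sub>C x j)
      = distr (distr (PiM UNIV (\<lambda>_. circle_uniform)) (PiM J (\<lambda>_. circle_uniform)) (\<lambda>\<omega>. restrict \<omega> J))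
          borel (\<lambda>ch. \<Sum>j\<in>J. ch j *\<^sub>C x j)"
    by (subst distr_PiM_restrict_finite[OF assms]) auto
  also have "\<dots> = distr steinhaus_space borel (steinhaus_sum J x)"
    unfolding steinhaus_space_def
    by (subst distr_distr) (auto simp: steinhaus_sum_def comp_def intro!: distr_cong sum.cong)
  finally show ?thesis .
qed

text \<open>Independence of the coordinates survives the sign changes, and each marginal is
  invariant under negation; the joint law is therefore the same product.\<close>

lemma distr_steinhaus_space_signs:
  fixes e :: "nat \<Rightarrow> real"
  assumes e: "\<And>k. e k \<in> {-1, 1}"
  shows "distr steinhaus_space steinhaus_space (\<lambda>\<omega> k. of_real (e k) * \<omega> k) = steinhaus_space"
proof -
  interpret prob_space steinhaus_space by (rule prob_space_steinhaus_space)
  have proj: "distr steinhaus_space circle_uniform (\<lambda>\<omega>. \<omega> k) = circle_uniform" for k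
    unfolding steinhaus_space_def by (intro distr_PiM_component prob_space_circle_uniform) auto
  have m [measurable]: "(\<lambda>\<omega>. \<omega> k) \<in> measurable steinhaus_space circle_uniform" for k
    unfolding steinhaus_space_def by measurable
  have m2: "(*) (complex_of_real (e k)) \<in> measurable circle_uniform circle_uniform" for k
    unfolding measurable_cong_sets[OF sets_circle_uniform sets_circle_uniform]
    by (intro borel_measurable_continuous_onI continuous_intros)
  have "indep_vars (\<lambda>_. circle_uniform) (\<lambda>k \<omega>. \<omega> k) UNIV"
    by (subst indep_vars_iff_distr_eq_PiM)
      (auto simp: proj steinhaus_space_def[symmetric] restrict_UNIV intro!: distr_id2)
  then have "indep_vars (\<lambda>_. circle_uniform) (\<lambda>k \<omega>. of_real (e k) * \<omega> k) UNIV"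
    by (rule indep_vars_compose2) (use m2 in simp)
  then have "distr steinhaus_space (PiM UNIV (\<lambda>_. circle_uniform)) (\<lambda>\<omega>. \<lambda>k\<in>UNIV. of_real (e k) * \<omega> k)
      = PiM UNIV (\<lambda>k. distr steinhaus_space circle_uniform (\<lambda>\<omega>. of_real (e k) * \<omega> k))"
    by (subst (asm) indep_vars_iff_distr_eq_PiM) (auto intro!: measurable_compose[OF m m2])
  also have "(\<lambda>k. distr steinhaus_space circle_uniform (\<lambda>\<omega>. of_real (e k) * \<omega> k)) = (\<lambda>_. circle_uniform)"
  proof
    fix k
    have "distr steinhaus_space circle_uniform (\<lambda>\<omega>. of_real (e k) * \<omega> k)
        = distr (distr steinhaus_space circle_uniform (\<lambda>\<omega>. \<omega> k)) circle_uniform (\<lambda>z. of_real (e k) * z)"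
      by (subst distr_distr) (auto simp: comp_def m2)
    also have "\<dots> = distr circle_uniform circle_uniform (\<lambda>z. of_real (e k) * z)" by (simp add: proj)
    also have "\<dots> = circle_uniform"
      using e[of k] by (auto simp: distr_circle_uniform_uminus distr_id2)
    finally show "distr steinhaus_space circle_uniform (\<lambda>\<omega>. of_real (e k) * \<omega> k) = circle_uniform" .
  qed
  finally show ?thesis by (simp add: restrict_UNIV steinhaus_space_def[symmetric])
qed

text \<open>By sign invariance, the \<open>p\<close>-th moment equals its average over all sign
  vectors. For fixed unimodular \<open>\<omega>\<close> the type inequality, applied to the vectors
  \<open>\<omega> i *\<^sub>C y i\<close>, bounds that average by norms that do not involve
  \<open>\<omega>\<close>. Markov's inequality then gives the tail.\<close>

lemma type_steinhaus_tail:
  fixes C' p :: real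
  assumes "p > 0"
    and type: "\<And>(n::nat) (x::nat \<Rightarrow> 'a::{complex_normed_vector, second_countable_topology}).
     (\<Sum>\<epsilon>\<in>PiE {..<n} (\<lambda>_. {-1, 1::real}). norm (\<Sum>i<n. \<epsilon> i *\<^sub>R x i) powr p) / 2 ^ n
       \<le> C' * (\<Sum>i<n. norm (x i) powr p)"
    and "finite J" and "a > 0"
  shows "measure steinhaus_space {\<omega> \<in> space steinhaus_space. norm (steinhaus_sum J x \<omega>) \<ge> a}
    \<le> C' * (\<Sum>j\<in>J. norm (x j :: 'a) powr p) / a powr p"
proof -
  interpret prob_space steinhaus_space by (rule prob_space_steinhaus_space)
  obtain n where n: "J \<subseteq> {..<n}" using \<open>finite J\<close> finite_nat_iff_bounded by blast
  \<comment> \<open>The type inequality is stated for initial segments of \<open>nat\<close>; zero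
    vectors fill the gaps of \<open>J\<close> below \<open>n\<close>.\<close>
  define y where "y j = (if j \<in> J then x j else 0)" for j
  define S where "S = PiE {..<n} (\<lambda>_. {-1, 1::real})"
  define s where "s = (\<Sum>j\<in>J. norm (x j) powr p)"
  define f where "f \<omega> = norm (steinhaus_sum J x \<omega>) powr p" for \<omega>
  define F where "F = (\<integral>\<^sup>+\<omega>. ennreal (f \<omega>) \<partial>steinhaus_space)"
  have f [measurable]: "f \<in> borel_measurable steinhaus_space" unfolding f_def by measurable
  have finS: "finite S" unfolding S_def by (intro finite_PiE) auto
  have cardS: "card S = 2 ^ n" unfolding S_def by (simp add: card_PiE numeral_2_eq_2)
  \<comment> \<open>Members of \<open>S\<close> are \<open>undefined\<close> from \<open>n\<close>
    on, so the sign there is set to 1.\<close>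
  define sg where "sg \<epsilon> \<omega> = (\<lambda>k. of_real (if k < n then \<epsilon> k else 1) * \<omega> k)" for \<epsilon> :: "nat \<Rightarrow> real" and \<omega> :: "nat \<Rightarrow> complex"
  have sgm [measurable]: "sg \<epsilon> \<in> measurable steinhaus_space steinhaus_space" for \<epsilon>
    unfolding sg_def steinhaus_space_def
    by (intro measurable_PiM_single') (auto simp: space_PiM)
  have inv: "(\<integral>\<^sup>+\<omega>. ennreal (f (sg \<epsilon> \<omega>)) \<partial>steinhaus_space) = F" if "\<epsilon> \<in> S" for \<epsilon>
  proof -
    have "distr steinhaus_space steinhaus_space (sg \<epsilon>) = steinhaus_space"
      unfolding sg_def using that
      by (intro distr_steinhaus_space_signs) (auto simp: S_def PiE_iff)
    then have "F = (\<integral>\<^sup>+\<omega>. ennreal (f \<omega>) \<partial>distr steinhaus_space steinhaus_space (sg \<epsilon>))"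
      by (simp add: F_def)
    then show ?thesis by (subst (asm) nn_integral_distr) auto
  qed
  have fsg: "f (sg \<epsilon> \<omega>) = norm (\<Sum>i<n. \<epsilon> i *\<^sub>R (\<omega> i *\<^sub>C y i)) powr p" for \<epsilon> \<omega>
  proof -
    have "steinhaus_sum J x (sg \<epsilon> \<omega>) = (\<Sum>i\<in>J. \<epsilon> i *\<^sub>R (\<omega> i *\<^sub>C y i))"
      unfolding steinhaus_sum_def sg_def y_def using n
      by (intro sum.cong) (auto simp: scaleC_scaleC scaleC_of_real[symmetric])
    also have "\<dots> = (\<Sum>i<n. \<epsilon> i *\<^sub>R (\<omega> i *\<^sub>C y i))"
    proof (rule sum.mono_neutral_left[OF _ n])
      show "\<forall>i\<in>{..<n} - J. \<epsilon> i *\<^sub>R (\<omega> i *\<^sub>C y i) = 0" by (simp add: y_def scaleC_zero_right)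
    qed simp
    finally show ?thesis by (simp add: f_def)
  qed
  have bound: "(\<Sum>\<epsilon>\<in>S. f (sg \<epsilon> \<omega>)) \<le> 2 ^ n * (C' * s)" if "\<forall>k. cmod (\<omega> k) = 1" for \<omega>
  proof -
    have "(\<Sum>i<n. norm (\<omega> i *\<^sub>C y i) powr p) = (\<Sum>i<n. norm (y i) powr p)"
      using that by (simp add: norm_scaleC)
    also have "\<dots> = s"
      unfolding s_def using n by (intro sum.mono_neutral_cong_right) (auto simp: y_def)
    finally have "(\<Sum>i<n. norm (\<omega> i *\<^sub>C y i) powr p) = s" .
    then show ?thesis
      using type[of "\<lambda>i. \<omega> i *\<^sub>C y i" n] by (simp add: fsg S_def field_simps)
  qed
  \<comment> \<open>The sign of \<open>C'\<close> is not prescribed; evaluating the bound at the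
    constant point 1 gives the nonnegativity needed in \<open>ennreal\<close>.\<close>
  have "C' * s \<ge> 0"
  proof -
    have "0 \<le> (\<Sum>\<epsilon>\<in>S. f (sg \<epsilon> (\<lambda>_. 1)))" by (intro sum_nonneg) (simp add: f_def)
    also have "\<dots> \<le> 2 ^ n * (C' * s)" by (intro bound) simp
    finally show ?thesis using mult_le_cancel_left_pos[of "2 ^ n" 0 "C' * s"] by simp
  qed
  have "ennreal (2 ^ n) * F = (\<Sum>\<epsilon>\<in>S. F)"
    using cardS by (simp add: ennreal_of_nat_eq_real_of_nat)
  also have "\<dots> = (\<Sum>\<epsilon>\<in>S. \<integral>\<^sup>+\<omega>. ennreal (f (sg \<epsilon> \<omega>)) \<partial>steinhaus_space)"
    by (intro sum.cong) (auto simp: inv)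
  also have "\<dots> = (\<integral>\<^sup>+\<omega>. (\<Sum>\<epsilon>\<in>S. ennreal (f (sg \<epsilon> \<omega>))) \<partial>steinhaus_space)"
    by (intro nn_integral_sum[symmetric]) measurable
  also have "\<dots> \<le> (\<integral>\<^sup>+\<omega>. ennreal (2 ^ n * (C' * s)) \<partial>steinhaus_space)"
    using AE_steinhaus_space_cmod
    by (intro nn_integral_mono_AE, eventually_elim)
      (use bound in \<open>auto simp: f_def sum_ennreal intro!: ennreal_leI\<close>)
  also have "\<dots> = ennreal (2 ^ n) * ennreal (C' * s)"
    using emeasure_space_1 \<open>C' * s \<ge> 0\<close> by (simp add: ennreal_mult')
  finally have F: "F \<le> ennreal (C' * s)"
    by (subst (asm) ennreal_mult_le_mult_iff) auto
  have "emeasure steinhaus_space {\<omega> \<in> space steinhaus_space. norm (steinhaus_sum J x \<omega>) \<ge> a}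
      = emeasure steinhaus_space {\<omega> \<in> space steinhaus_space. 1 \<le> ennreal (1 / a powr p) * ennreal (f \<omega>)}"
  proof (rule arg_cong[of _ _ "emeasure steinhaus_space"], rule Collect_cong, rule conj_cong[OF refl])
    fix \<omega>
    have "norm (steinhaus_sum J x \<omega>) \<ge> a \<longleftrightarrow> f \<omega> \<ge> a powr p"
      unfolding f_def using \<open>p > 0\<close> \<open>a > 0\<close> by (metis norm_ge_zero less_imp_le not_le powr_less_mono2 powr_mono2)
    then show "a \<le> norm (steinhaus_sum J x \<omega>) \<longleftrightarrow> 1 \<le> ennreal (1 / a powr p) * ennreal (f \<omega>)"
      using \<open>a > 0\<close> by (simp add: ennreal_mult'[symmetric] f_def field_simps)
  qed
  also have "\<dots> \<le> ennreal (1 / a powr p) * (\<integral>\<^sup>+\<omega>. ennreal (f \<omega>) * indicator (space steinhaus_space) \<omega> \<partial>steinhaus_space)"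
    by (rule nn_integral_Markov_inequality) measurable
  also have "\<dots> = ennreal (1 / a powr p) * F" by (simp add: F_def)
  also have "\<dots> \<le> ennreal (1 / a powr p) * ennreal (C' * s)" using F by (intro mult_left_mono) auto
  also have "\<dots> = ennreal (C' * s / a powr p)" using \<open>C' * s \<ge> 0\<close> by (simp add: ennreal_mult'[symmetric])
  finally show ?thesis
    using \<open>C' * s \<ge> 0\<close> unfolding emeasure_eq_measure s_def
    by (subst (asm) ennreal_le_iff) (auto intro!: divide_nonneg_nonneg simp: s_def)
qed

section \<open>Extending a Steinhaus sum\<close>

lemma scaleC_diff_left: "(a - b) *\<^sub>C (x::'a::complex_normed_vector) = a *\<^sub>C x - b *\<^sub>C x"
  by (metis add_diff_cancel_right' diff_add_cancel scaleC_add_left)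

lemma bounded_operator_funpow:
  assumes "bounded_operator T"
  shows "bounded_linear (T ^^ n)" and "(T ^^ n) (c *\<^sub>C x) = c *\<^sub>C (T ^^ n) x"
proof -
  have T: "bounded_linear T" "\<And>c x. T (c *\<^sub>C x) = c *\<^sub>C T x"
    using assms by (auto simp: bounded_operator_def)
  show "bounded_linear (T ^^ n)"
  proof (induction n)
    case 0
    then show ?case by (simp add: bounded_linear_ident id_def)
  next
    case (Suc n)
    then show ?case using bounded_linear_compose[OF T(1) Suc] by (simp add: comp_def)
  qed
  show "(T ^^ n) (c *\<^sub>C x) = c *\<^sub>C (T ^^ n) x"
    by (induction n) (auto simp: T(2))
qed

lemma bounded_operator_funpow_eigenvector:
  assumes "bounded_operator T" "T x = c *\<^sub>C x"
  shows "(T ^^ n) x = c ^ n *\<^sub>C x"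
proof (induction n)
  case (Suc n)
  have "T (c ^ n *\<^sub>C x) = c ^ n *\<^sub>C T x" using assms(1) by (simp add: bounded_operator_def)
  then show ?case using Suc assms(2) by (simp add: scaleC_scaleC mult.commute)
qed (simp add: scaleC_one)

text \<open>With \<open>L \<ge> 1\<close> the bounds increase in \<open>n\<close>, so
  \<open>L ^ N\<close> controls all iterates up to time \<open>N\<close>.\<close>

lemma bounded_operator_funpow_norm_le:
  assumes "bounded_operator T"
  obtains L where "L \<ge> 1" "\<And>n y. norm ((T ^^ n) y) \<le> L ^ n * norm y"
proof -
  obtain L0 where L0: "\<And>y. norm (T y) \<le> norm y * L0"
    using assms bounded_linear.bounded unfolding bounded_operator_def by blast
  define L where "L = max 1 L0"
  have L: "L \<ge> 1" "norm (T y) \<le> L * norm y" for y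
  proof -
    have "norm y * L0 \<le> norm y * L" by (intro mult_left_mono) (auto simp: L_def)
    then show "norm (T y) \<le> L * norm y" using L0[of y] by (simp add: mult.commute)
  qed (simp add: L_def)
  have "norm ((T ^^ n) y) \<le> L ^ n * norm y" for n y
  proof (induction n)
    case (Suc n)
    have "norm ((T ^^ Suc n) y) \<le> L * norm ((T ^^ n) y)" using L(2) by simp
    also have "\<dots> \<le> L * (L ^ n * norm y)" using Suc L(1) by (intro mult_left_mono) auto
    finally show ?case by simp
  qed simp
  with L(1) that show ?thesis by blast
qed

lemma funpow_steinhaus_sum:
  assumes T: "bounded_operator T" and "\<And>j. j \<in> J \<Longrightarrow> T (x j) = lam j *\<^sub>C x j"
  shows "(T ^^ n) (steinhaus_sum J x \<omega>) = (\<Sum>j\<in>J. (lam j ^ n * \<omega> j) *\<^sub>C x j)"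
proof -
  have "(T ^^ n) (steinhaus_sum J x \<omega>) = (\<Sum>j\<in>J. (T ^^ n) (\<omega> j *\<^sub>C x j))"
    unfolding steinhaus_sum_def
    by (rule linear_sum[OF bounded_linear.linear[OF bounded_operator_funpow(1)[OF T]]])
  also have "\<dots> = (\<Sum>j\<in>J. (lam j ^ n * \<omega> j) *\<^sub>C x j)"
    using assms(2) by (intro sum.cong)
      (auto simp: bounded_operator_funpow(2)[OF T] bounded_operator_funpow_eigenvector[OF T] scaleC_scaleC mult.commute)
  finally show ?thesis .
qed

definition small_independent_eigenvectors :: "('a::complex_normed_vector \<Rightarrow> 'a) \<Rightarrow> real \<Rightarrow> real \<Rightarrow> bool" where
  "small_independent_eigenvectors T p C \<longleftrightarrow>
     (\<forall>\<Omega>::'a set. open \<Omega> \<and> \<Omega> \<noteq> {} \<and> T -` \<Omega> \<subseteq> \<Omega> \<longrightarrow>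
           (\<exists>K::nat set. \<exists>u::nat \<Rightarrow> 'a. \<exists>lam::nat \<Rightarrow> complex. finite K \<and>
              (\<forall>k\<in>K. unimodular_eigenvector T (u k) (lam k)) \<and> independent_family K lam \<and>
              (\<Sum>k\<in>K. u k) \<in> \<Omega> \<and> (\<Sum>k\<in>K. norm (u k) powr p) \<le> C))"

text \<open>Shifting the indices makes a new family disjoint from the finite set already in
  use.\<close>

lemma independent_family_shift:
  assumes "independent_family K l"
  shows "independent_family ((\<lambda>k. k + b) ` K) (\<lambda>i::nat. l (i - b))"
  unfolding independent_family_def
proof (intro allI impI)
  fix m :: "nat \<Rightarrow> int"
  assume "(\<Prod>i\<in>(\<lambda>k. k + b) ` K. l (i - b) powi m i) = 1"
  then have "(\<Prod>k\<in>K. l k powi m (k + b)) = 1"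
    by (subst (asm) prod.reindex) (auto simp: inj_on_def)
  then have "\<forall>k\<in>K. m (k + b) = 0"
    using assms[unfolded independent_family_def, rule_format, of "\<lambda>k. m (k + b)"] by blast
  then show "\<forall>i\<in>(\<lambda>k. k + b) ` K. m i = 0" by blast
qed

text \<open>Applying the hypothesis to a large multiple of a ball and rescaling makes the vectors small.
  Independence over the finite family \<open>J\<close> then costs at most \<open>card J\<close> of them, whose total norm is
  negligible.\<close>
lemma ex_small_eigenvectors_independent_over:
  fixes T :: "'a::complex_normed_vector \<Rightarrow> 'a"
  assumes T: "bounded_operator T" and "p > 0" and hyp: "small_independent_eigenvectors T p C"
    and J: "finite (J :: nat set)" "\<And>j. j \<in> J \<Longrightarrow> cmod (lam j) = 1" and "\<epsilon> > 0" "\<delta> > 0"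
  obtains K v \<mu> where "finite K" "J \<inter> K = {}"
    "\<And>k. k \<in> K \<Longrightarrow> unimodular_eigenvector T (v k) (\<mu> k)"
    "\<And>j. j \<in> J \<Longrightarrow> \<mu> j = lam j"
    "independent_over J K \<mu>"
    "norm ((\<Sum>k\<in>K. v k) - w) < \<epsilon>"
    "(\<Sum>k\<in>K. norm (v k) powr p) \<le> \<delta>"
proof -
  have "C \<ge> 0"
  proof -
    obtain K :: "nat set" and u :: "nat \<Rightarrow> 'a" where "(\<Sum>k\<in>K. norm (u k) powr p) \<le> C"
      using hyp[unfolded small_independent_eigenvectors_def, rule_format, of UNIV] by auto
    then show ?thesis using sum_nonneg[of K "\<lambda>k. norm (u k) powr p"] by auto
  qed
  define c where "c = C powr (1 / p)"
  \<comment> \<open>The number \<open>c\<close> bounds every single \<open>norm (u k)\<close>. In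
    \<open>N\<close>, the first summand gives positivity, the second makes \<open>card J\<close>
    dropped vectors of norm at most \<open>c / N\<close> negligible, and the third brings
    \<open>C / N powr p\<close> below \<open>\<delta>\<close>.\<close>
  define N where "N = 1 + 2 * real (card J) * c / \<epsilon> + (C / \<delta>) powr (1 / p)"
  have "c \<ge> 0" by (simp add: c_def)
  then have t1: "2 * real (card J) * c / \<epsilon> \<ge> 0" using \<open>\<epsilon> > 0\<close> by simp
  have t2: "(C / \<delta>) powr (1 / p) \<ge> 0" by simp
  have N: "N > 0" using t1 t2 unfolding N_def by linarith
  have "2 * real (card J) * c / \<epsilon> \<le> N" using t2 by (simp add: N_def)
  then have Nc: "real (card J) * (c / N) \<le> \<epsilon> / 2" using N \<open>\<epsilon> > 0\<close> by (simp add: field_simps)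
  have "C / \<delta> = ((C / \<delta>) powr (1 / p)) powr p"
    using \<open>p > 0\<close> \<open>C \<ge> 0\<close> \<open>\<delta> > 0\<close> by (simp add: powr_powr)
  also have "\<dots> \<le> N powr p" using t1 \<open>p > 0\<close> by (intro powr_mono2) (auto simp: N_def)
  finally have Nd: "C / N powr p \<le> \<delta>" using N \<open>\<delta> > 0\<close> by (simp add: field_simps)

  \<comment> \<open>The vectors whose orbit meets the ball dilated by \<open>N\<close>. Allowing
    every \<open>n\<close> gives backward invariance; the time actually used only multiplies each
    eigenvector by a unimodular number.\<close>
  define \<Omega> where "\<Omega> = (\<Union>n. (\<lambda>y. (1 / N) *\<^sub>R (T ^^ n) y) -` ball w (\<epsilon> / 2))"
  have "open \<Omega>"
    unfolding \<Omega>_def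
  proof (intro open_UN ballI open_vimage open_ball)
    fix n
    show "continuous_on UNIV (\<lambda>y. (1 / N) *\<^sub>R (T ^^ n) y)"
      by (intro continuous_intros linear_continuous_on bounded_operator_funpow(1)[OF T])
  qed
  moreover have "N *\<^sub>R w \<in> (\<lambda>y. (1 / N) *\<^sub>R (T ^^ 0) y) -` ball w (\<epsilon> / 2)" using N \<open>\<epsilon> > 0\<close> by simp
  then have "\<Omega> \<noteq> {}" unfolding \<Omega>_def by blast
  moreover have "T -` \<Omega> \<subseteq> \<Omega>"
  proof
    fix y assume "y \<in> T -` \<Omega>"
    then obtain n where "(1 / N) *\<^sub>R (T ^^ n) (T y) \<in> ball w (\<epsilon> / 2)" unfolding \<Omega>_def by blast
    then have "(1 / N) *\<^sub>R (T ^^ Suc n) y \<in> ball w (\<epsilon> / 2)" by (simp add: funpow_swap1)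
    then show "y \<in> \<Omega>" unfolding \<Omega>_def by blast
  qed
  ultimately obtain K0 :: "nat set" and u l where K0: "finite K0"
    "\<forall>k\<in>K0. unimodular_eigenvector T (u k) (l k)" "independent_family K0 l"
    "(\<Sum>k\<in>K0. u k) \<in> \<Omega>" "(\<Sum>k\<in>K0. norm (u k) powr p) \<le> C"
    using hyp[unfolded small_independent_eigenvectors_def, rule_format, of \<Omega>] by blast
  obtain n where n: "norm ((1 / N) *\<^sub>R (T ^^ n) (\<Sum>k\<in>K0. u k) - w) < \<epsilon> / 2"
    using K0(4) by (auto simp: \<Omega>_def dist_norm norm_minus_commute)

  obtain b where b: "J \<subseteq> {..<b}" using J(1) finite_nat_iff_bounded by blast
  define K1 where "K1 = (\<lambda>k. k + b) ` K0"
  define \<mu> where "\<mu> i = (if i \<in> J then lam i else l (i - b))" for i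
  \<comment> \<open>This is \<open>T ^^ n\<close> applied to the original eigenvector, rescaled: the
    same eigenvalue, and norm divided by \<open>N\<close>.\<close>
  define v where "v i = (1 / N) *\<^sub>R ((l (i - b)) ^ n *\<^sub>C u (i - b))" for i
  have inj: "inj_on (\<lambda>k. k + b) K0" by (auto simp: inj_on_def)
  have finK1: "finite K1" using K0(1) by (simp add: K1_def)
  have disj: "J \<inter> K1 = {}" using b by (auto simp: K1_def)
  have \<mu>K: "\<mu> i = l (i - b)" if "i \<in> K1" for i using disj that by (auto simp: \<mu>_def)
  have eig: "unimodular_eigenvector T (u (i - b)) (l (i - b))" if "i \<in> K1" for i
    using K0(2) that by (auto simp: K1_def)
  have "independent_family K1 \<mu>"
    using independent_family_shift[OF K0(3), of b] \<mu>K
    by (simp add: independent_family_def K1_def cong: prod.cong)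
  moreover have "\<mu> i \<noteq> 0" if "i \<in> J \<union> K1" for i
  proof -
    have "cmod (\<mu> i) = 1"
      using that J(2)[of i] eig[of i] \<mu>K[of i] by (auto simp: \<mu>_def unimodular_eigenvector_def)
    then show ?thesis by auto
  qed
  ultimately obtain K where K: "K \<subseteq> K1" "card (K1 - K) \<le> card J" "independent_over J K \<mu>"
    using independent_over_subfamily[OF J(1) finK1 disj] by blast
  have normv: "norm (v i) = norm (u (i - b)) / N" if "i \<in> K1" for i
    using eig[OF that] N by (simp add: v_def norm_scaleC norm_power unimodular_eigenvector_def)
  have sumpow: "(\<Sum>i\<in>K1. norm (u (i - b)) powr p) \<le> C"
    using K0(5) inj by (simp add: K1_def sum.reindex)
  have vle: "norm (v i) \<le> c / N" if "i \<in> K1" for i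
  proof -
    have "norm (u (i - b)) powr p \<le> (\<Sum>i\<in>K1. norm (u (i - b)) powr p)"
      using that finK1 by (intro member_le_sum) auto
    then have "norm (u (i - b)) powr p \<le> C" using sumpow by simp
    then have "(norm (u (i - b)) powr p) powr (1 / p) \<le> c"
      unfolding c_def using \<open>p > 0\<close> by (intro powr_mono2) auto
    then show ?thesis using \<open>p > 0\<close> N normv[OF that] by (simp add: powr_powr divide_right_mono)
  qed
  have sumv: "(\<Sum>i\<in>K1. v i) = (1 / N) *\<^sub>R (T ^^ n) (\<Sum>k\<in>K0. u k)"
  proof -
    have "(T ^^ n) (\<Sum>k\<in>K0. u k) = (\<Sum>k\<in>K0. (T ^^ n) (u k))"
      by (rule linear_sum[OF bounded_linear.linear[OF bounded_operator_funpow(1)[OF T]]])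
    also have "\<dots> = (\<Sum>k\<in>K0. l k ^ n *\<^sub>C u k)"
      using K0(2) by (intro sum.cong)
        (auto simp: unimodular_eigenvector_def bounded_operator_funpow_eigenvector[OF T])
    finally show ?thesis
      using inj by (simp add: K1_def v_def sum.reindex scaleR_sum_right)
  qed
  have "norm (\<Sum>i\<in>K1 - K. v i) \<le> of_nat (card (K1 - K)) * (c / N)"
    using vle by (intro sum_norm_bound) auto
  also have "\<dots> \<le> real (card J) * (c / N)"
    using K(2) \<open>c \<ge> 0\<close> N by (intro mult_right_mono) auto
  finally have drop: "norm (\<Sum>i\<in>K1 - K. v i) \<le> \<epsilon> / 2" using Nc by linarith
  show ?thesis
  proof (rule that[of K v \<mu>])
    show "finite K" using K(1) finK1 finite_subset by blast
    show "J \<inter> K = {}" using disj K(1) by blast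
    show "\<mu> j = lam j" if "j \<in> J" for j using that by (simp add: \<mu>_def)
    show "independent_over J K \<mu>" by fact
    show "unimodular_eigenvector T (v k) (\<mu> k)" if "k \<in> K" for k
    proof -
      have k: "k \<in> K1" using that K(1) by blast
      have "v k = (of_real (1 / N) * l (k - b) ^ n) *\<^sub>C u (k - b)"
        by (simp only: v_def scaleC_of_real[symmetric] scaleC_scaleC)
      then have "T (v k) = l (k - b) *\<^sub>C v k"
        using T eig[OF k] by (simp add: bounded_operator_def unimodular_eigenvector_def scaleC_scaleC mult_ac)
      moreover have "norm (v k) \<noteq> 0"
        using normv[OF k] eig[OF k] N by (simp add: unimodular_eigenvector_def)
      then have "v k \<noteq> 0" by auto
      ultimately show ?thesis
        using eig[OF k] \<mu>K[OF k] by (simp add: unimodular_eigenvector_def)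
    qed
    have eq: "(\<Sum>i\<in>K. v i) - w = ((1 / N) *\<^sub>R (T ^^ n) (\<Sum>k\<in>K0. u k) - w) - (\<Sum>i\<in>K1 - K. v i)"
      using K(1) finK1 by (simp add: sumv[symmetric] sum_diff)
    show "norm ((\<Sum>k\<in>K. v k) - w) < \<epsilon>"
      unfolding eq using norm_triangle_ineq4[of "(1 / N) *\<^sub>R (T ^^ n) (\<Sum>k\<in>K0. u k) - w" "\<Sum>i\<in>K1 - K. v i"] n drop
      by linarith
    have "(\<Sum>k\<in>K. norm (v k) powr p) \<le> (\<Sum>k\<in>K1. norm (v k) powr p)"
      using K(1) finK1 by (intro sum_mono2) auto
    also have "\<dots> = (\<Sum>i\<in>K1. norm (u (i - b)) powr p) / N powr p"
      using normv N by (simp add: sum_divide_distrib powr_divide)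
    also have "\<dots> \<le> C / N powr p" using sumpow by (intro divide_right_mono) auto
    finally show "(\<Sum>k\<in>K. norm (v k) powr p) \<le> \<delta>" using Nd by simp
  qed
qed

text \<open>One step of the construction. The given \<open>M\<close> bounds the iterates used so
  far, so the increment is measured after multiplication by \<open>M\<close>; \<open>M'\<close>
  additionally bounds every iterate this step may use, whatever \<open>\<omega>\<close> is.\<close>

lemma ex_steinhaus_extension:
  fixes T :: "'a::{complex_normed_vector, second_countable_topology} \<Rightarrow> 'a"
  assumes T: "bounded_operator T" and "p > 0" and type: "has_type p TYPE('a)"
    and hyp: "small_independent_eigenvectors T p C"
    and J: "finite J" "\<forall>j\<in>J. \<exists>c. unimodular_eigenvector T (x j) c"
    and "\<epsilon> > 0" "M > 0" "\<tau> > 0"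
  shows "\<exists>J' x' M'. finite J' \<and> (\<forall>j\<in>J'. \<exists>c. unimodular_eigenvector T (x' j) c) \<and> M \<le> M' \<and>
    measure steinhaus_space {\<omega> \<in> space steinhaus_space.
      \<tau> \<le> M * norm (steinhaus_sum J' x' \<omega> - steinhaus_sum J x \<omega>)} \<le> \<tau> \<and>
    (\<forall>\<omega>. (\<forall>k. cmod (\<omega> k) = 1) \<longrightarrow> (\<exists>n. (\<forall>y. norm ((T ^^ n) y) \<le> M' * norm y) \<and>
      norm ((T ^^ n) (steinhaus_sum J' x' \<omega>) - (steinhaus_sum J x \<omega> + w)) < \<epsilon>))"
proof -
  obtain lam where lam: "unimodular_eigenvector T (x j) (lam j)" if "j \<in> J" for j
    using J(2) by metis
  obtain C0 where C0: "\<And>(n::nat) (x::nat \<Rightarrow> 'a).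
     (\<Sum>\<epsilon>\<in>PiE {..<n} (\<lambda>_. {-1, 1::real}). norm (\<Sum>i<n. \<epsilon> i *\<^sub>R x i) powr p) / 2 ^ n
       \<le> C0 * (\<Sum>i<n. norm (x i) powr p)"
    using type unfolding has_type_def by blast
  \<comment> \<open>Raising the type constant to at least 1 permits division by it;
    \<open>\<delta>\<close> is then the value for which the tail bound at level
    \<open>\<tau> / M\<close> equals \<open>\<tau>\<close>.\<close>
  define C' where "C' = max 1 C0"
  define \<delta> where "\<delta> = \<tau> * (\<tau> / M) powr p / C'"
  have "\<delta> > 0" using \<open>\<tau> > 0\<close> \<open>M > 0\<close> by (simp add: \<delta>_def C'_def)
  have lam1: "cmod (lam j) = 1" if "j \<in> J" for j using lam[OF that] by (simp add: unimodular_eigenvector_def)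
  have "\<epsilon> / 2 > 0" using \<open>\<epsilon> > 0\<close> by simp
  obtain K v \<mu> where K: "finite K" "J \<inter> K = {}"
    "\<And>k. k \<in> K \<Longrightarrow> unimodular_eigenvector T (v k) (\<mu> k)" "\<And>j. j \<in> J \<Longrightarrow> \<mu> j = lam j"
    "independent_over J K \<mu>" and w: "norm ((\<Sum>k\<in>K. v k) - w) < \<epsilon> / 2"
    and small: "(\<Sum>k\<in>K. norm (v k) powr p) \<le> \<delta>"
    by (rule ex_small_eigenvectors_independent_over[OF T \<open>p > 0\<close> hyp J(1) _ \<open>\<epsilon> / 2 > 0\<close> \<open>\<delta> > 0\<close>,
          where lam = lam and w = w]) (rule lam1, assumption, rule that)
  define J' where "J' = J \<union> K"
  define x' where "x' i = (if i \<in> J then x i else v i)" for i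
  have eig: "unimodular_eigenvector T (x' i) (\<mu> i)" if "i \<in> J'" for i
    using that lam K(3,4) by (auto simp: J'_def x'_def)
  then have \<mu>1: "cmod (\<mu> i) = 1" if "i \<in> J \<union> K" for i
    using that by (auto simp: J'_def unimodular_eigenvector_def)
  have split: "(\<Sum>i\<in>J'. f i (x' i)) = (\<Sum>j\<in>J. f j (x j)) + (\<Sum>k\<in>K. f k (v k))" for f :: "nat \<Rightarrow> 'a \<Rightarrow> 'a"
  proof -
    have "(\<Sum>i\<in>J'. f i (x' i)) = (\<Sum>i\<in>J. f i (x' i)) + (\<Sum>i\<in>K. f i (x' i))"
      unfolding J'_def by (rule sum.union_disjoint[OF J(1) K(1,2)])
    also have "(\<Sum>i\<in>J. f i (x' i)) = (\<Sum>j\<in>J. f j (x j))" by (simp add: x'_def)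
    also have "(\<Sum>i\<in>K. f i (x' i)) = (\<Sum>k\<in>K. f k (v k))"
      using K(2) by (intro sum.cong) (auto simp: x'_def)
    finally show ?thesis .
  qed
  have S': "steinhaus_sum J' x' \<omega> = steinhaus_sum J x \<omega> + steinhaus_sum K v \<omega>" for \<omega>
    unfolding steinhaus_sum_def using split[of "\<lambda>i y. \<omega> i *\<^sub>C y"] .

  have tail: "measure steinhaus_space {\<omega> \<in> space steinhaus_space.
      \<tau> \<le> M * norm (steinhaus_sum J' x' \<omega> - steinhaus_sum J x \<omega>)} \<le> \<tau>"
  proof -
    have C'0: "C' > 0" by (simp add: C'_def)
    have a: "\<tau> / M > 0" using \<open>\<tau> > 0\<close> \<open>M > 0\<close> by simp
    have type': "(\<Sum>\<epsilon>\<in>PiE {..<n} (\<lambda>_. {-1, 1::real}). norm (\<Sum>i<n. \<epsilon> i *\<^sub>R x i) powr p) / 2 ^ n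
       \<le> C' * (\<Sum>i<n. norm (x i) powr p)" for n and x :: "nat \<Rightarrow> 'a"
    proof -
      have "C0 * (\<Sum>i<n. norm (x i) powr p) \<le> C' * (\<Sum>i<n. norm (x i) powr p)"
        by (intro mult_right_mono) (auto simp: C'_def sum_nonneg)
      then show ?thesis using C0[where n = n and x = x] by linarith
    qed
    have "{\<omega> \<in> space steinhaus_space. \<tau> \<le> M * norm (steinhaus_sum J' x' \<omega> - steinhaus_sum J x \<omega>)}
        = {\<omega> \<in> space steinhaus_space. norm (steinhaus_sum K v \<omega>) \<ge> \<tau> / M}"
      using \<open>M > 0\<close> by (simp add: S' field_simps)
    also have "measure steinhaus_space \<dots> \<le> C' * (\<Sum>k\<in>K. norm (v k) powr p) / (\<tau> / M) powr p"
      by (rule type_steinhaus_tail[OF \<open>p > 0\<close> type' K(1) a])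
    also have "\<dots> \<le> C' * \<delta> / (\<tau> / M) powr p"
      using small C'0 by (intro divide_right_mono mult_left_mono) auto
    also have "\<dots> = \<tau>" unfolding \<delta>_def using C'0 a \<open>M > 0\<close> by simp
    finally show ?thesis .
  qed

  obtain L where L: "L \<ge> 1" "\<And>n y. norm ((T ^^ n) y) \<le> L ^ n * norm y"
    using bounded_operator_funpow_norm_le[OF T] by blast
  define s where "s = (\<Sum>j\<in>J. norm (x j)) + (\<Sum>k\<in>K. norm (v k))"
  define \<epsilon>' where "\<epsilon>' = \<epsilon> / 2 / (1 + s)"
  have "s \<ge> 0" unfolding s_def by (intro add_nonneg_nonneg sum_nonneg) auto
  then have \<epsilon>': "\<epsilon>' > 0" "\<epsilon>' * s \<le> \<epsilon> / 2"
    using \<open>\<epsilon> > 0\<close> by (auto simp: \<epsilon>'_def field_simps)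
  obtain N where N: "\<And>\<theta>. \<forall>k\<in>K. cmod (\<theta> k) = 1 \<Longrightarrow>
    \<exists>n\<le>N. (\<forall>j\<in>J. cmod (\<mu> j ^ n - 1) < \<epsilon>') \<and> (\<forall>k\<in>K. cmod (\<mu> k ^ n - \<theta> k) < \<epsilon>')"
    using kronecker_unimodular_uniform[OF J(1) K(1,2) \<mu>1 K(5) \<epsilon>'(1)] by metis
  define M' where "M' = max M (L ^ N)"
  have approx: "\<exists>n. (\<forall>y. norm ((T ^^ n) y) \<le> M' * norm y) \<and>
      norm ((T ^^ n) (steinhaus_sum J' x' \<omega>) - (steinhaus_sum J x \<omega> + w)) < \<epsilon>"
    if \<omega>: "\<forall>k. cmod (\<omega> k) = 1" for \<omega>
  proof -
    obtain n where n: "n \<le> N" "\<And>j. j \<in> J \<Longrightarrow> cmod (\<mu> j ^ n - 1) < \<epsilon>'"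
      "\<And>k. k \<in> K \<Longrightarrow> cmod (\<mu> k ^ n - cnj (\<omega> k)) < \<epsilon>'"
      \<comment> \<open>With these targets \<open>\<mu> k ^ n * \<omega> k\<close> is close to 1, so
        the random block is carried near the deterministic sum of the \<open>v k\<close>.\<close>
      using N[of "\<lambda>k. cnj (\<omega> k)"] \<omega> by auto
    have bd: "norm ((T ^^ n) y) \<le> M' * norm y" for y
    proof -
      have "L ^ n \<le> M'" using power_increasing[OF n(1) L(1)] by (simp add: M'_def)
      then have "L ^ n * norm y \<le> M' * norm y" by (intro mult_right_mono) auto
      then show ?thesis using L(2)[of n y] by linarith
    qed
    have "(T ^^ n) (steinhaus_sum J' x' \<omega>) = (\<Sum>i\<in>J'. (\<mu> i ^ n * \<omega> i) *\<^sub>C x' i)"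
      using eig by (intro funpow_steinhaus_sum[OF T]) (auto simp: unimodular_eigenvector_def)
    also have "\<dots> = (\<Sum>j\<in>J. (\<mu> j ^ n * \<omega> j) *\<^sub>C x j) + (\<Sum>k\<in>K. (\<mu> k ^ n * \<omega> k) *\<^sub>C v k)"
      using split[of "\<lambda>i y. (\<mu> i ^ n * \<omega> i) *\<^sub>C y"] .
    finally have "(T ^^ n) (steinhaus_sum J' x' \<omega>) - (steinhaus_sum J x \<omega> + (\<Sum>k\<in>K. v k))
        = (\<Sum>j\<in>J. (\<mu> j ^ n * \<omega> j - \<omega> j) *\<^sub>C x j) + (\<Sum>k\<in>K. (\<mu> k ^ n * \<omega> k - 1) *\<^sub>C v k)"
      by (simp add: steinhaus_sum_def scaleC_diff_left sum_subtractf scaleC_one)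
    also have "norm \<dots> \<le> (\<Sum>j\<in>J. \<epsilon>' * norm (x j)) + (\<Sum>k\<in>K. \<epsilon>' * norm (v k))"
    proof (intro norm_triangle_le add_mono sum_norm_le)
      fix j assume "j \<in> J"
      have "\<mu> j ^ n * \<omega> j - \<omega> j = (\<mu> j ^ n - 1) * \<omega> j" by (simp add: algebra_simps)
      then have "cmod (\<mu> j ^ n * \<omega> j - \<omega> j) \<le> \<epsilon>'"
        using n(2)[OF \<open>j \<in> J\<close>] \<omega> by (simp add: norm_mult)
      then show "norm ((\<mu> j ^ n * \<omega> j - \<omega> j) *\<^sub>C x j) \<le> \<epsilon>' * norm (x j)"
        by (simp add: norm_scaleC mult_right_mono)
    next
      fix k assume "k \<in> K"
      have "cnj (\<omega> k) * \<omega> k = 1" using \<omega> complex_norm_square[of "\<omega> k"] by (simp add: mult.commute)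
      then have "\<mu> k ^ n * \<omega> k - 1 = (\<mu> k ^ n - cnj (\<omega> k)) * \<omega> k" by (simp add: algebra_simps)
      then have "cmod (\<mu> k ^ n * \<omega> k - 1) \<le> \<epsilon>'"
        using n(3)[OF \<open>k \<in> K\<close>] \<omega> by (simp add: norm_mult)
      then show "norm ((\<mu> k ^ n * \<omega> k - 1) *\<^sub>C v k) \<le> \<epsilon>' * norm (v k)"
        by (simp add: norm_scaleC mult_right_mono)
    qed
    also have "\<dots> = \<epsilon>' * s" by (simp add: s_def sum_distrib_left distrib_left)
    finally have "norm ((T ^^ n) (steinhaus_sum J' x' \<omega>) - (steinhaus_sum J x \<omega> + (\<Sum>k\<in>K. v k))) \<le> \<epsilon> / 2"
      using \<epsilon>'(2) by linarith
    with w have "norm (((T ^^ n) (steinhaus_sum J' x' \<omega>) - (steinhaus_sum J x \<omega> + (\<Sum>k\<in>K. v k)))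
        + ((\<Sum>k\<in>K. v k) - w)) < \<epsilon>"
      using norm_triangle_ineq[of "(T ^^ n) (steinhaus_sum J' x' \<omega>) - (steinhaus_sum J x \<omega> + (\<Sum>k\<in>K. v k))"
          "(\<Sum>k\<in>K. v k) - w"] by linarith
    then have "norm ((T ^^ n) (steinhaus_sum J' x' \<omega>) - (steinhaus_sum J x \<omega> + w)) < \<epsilon>"
      by (simp add: algebra_simps)
    with bd show ?thesis by blast
  qed
  have "finite J'" using J(1) K(1) by (simp add: J'_def)
  moreover have "\<forall>j\<in>J'. \<exists>c. unimodular_eigenvector T (x' j) c" using eig by blast
  moreover have "M \<le> M'" by (simp add: M'_def)
  ultimately show ?thesis using tail approx by blast
qed

text \<open>Enumerating pairs \<open>(k, N)\<close> and keeping only \<open>k\<close> repeats each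
  point of a countable dense set at arbitrarily large indices, since
  \<open>prod_encode (k, N) \<ge> N\<close>.\<close>

lemma ex_recurrent_dense_sequence:
  "\<exists>w::nat \<Rightarrow> 'a::{real_normed_vector, second_countable_topology}.
     \<forall>v e N. e > 0 \<longrightarrow> (\<exists>i\<ge>N. norm (w i - v) < e)"
proof -
  obtain D :: "'a set" where D: "countable D" "\<And>X. open X \<Longrightarrow> X \<noteq> {} \<Longrightarrow> \<exists>d\<in>D. d \<in> X"
    using countable_dense_exists by blast
  have "\<exists>i\<ge>N. norm (from_nat_into D (fst (prod_decode i)) - v) < e" if "e > 0" for v e N
  proof -
    have "ball v e \<noteq> {}" using that by simp
    then obtain d where d: "d \<in> D" "d \<in> ball v e" using D(2)[OF open_ball] by blast
    then obtain k where "from_nat_into D k = d" using from_nat_into_surj[OF D(1)] by blast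
    with d show ?thesis
      by (intro exI[of _ "prod_encode (k, N)"]) (auto simp: dist_norm norm_minus_commute le_prod_encode_2)
  qed
  then show ?thesis by (intro exI[of _ "\<lambda>i. from_nat_into D (fst (prod_decode i))"]) blast
qed

text \<open>Telescoping; the exponent \<open>Suc l\<close> makes the increments from
  \<open>j\<close> on add up to exactly \<open>c * (1 / 2) ^ j\<close>.\<close>

lemma geometric_increments_limit:
  fixes y :: "nat \<Rightarrow> 'a::banach"
  assumes inc: "\<And>l. j \<le> l \<Longrightarrow> norm (y (Suc l) - y l) \<le> c * (1 / 2) ^ Suc l" and "c \<ge> 0"
  shows "convergent y" and "norm (lim y - y j) \<le> c * (1 / 2) ^ j"
proof -
  have step: "norm (y (i + m) - y i) \<le> c * ((1 / 2) ^ i - (1 / 2) ^ (i + m))" if "j \<le> i" for i m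
  proof (induction m)
    case (Suc m)
    have "norm (y (i + Suc m) - y i) \<le> norm (y (Suc (i + m)) - y (i + m)) + norm (y (i + m) - y i)"
      using norm_triangle_ineq[of "y (Suc (i + m)) - y (i + m)" "y (i + m) - y i"] by simp
    also have "\<dots> \<le> c * (1 / 2) ^ Suc (i + m) + c * ((1 / 2) ^ i - (1 / 2) ^ (i + m))"
      using inc[of "i + m"] Suc that by (intro add_mono) auto
    finally show ?case by (simp add: algebra_simps)
  qed simp
  have bound: "norm (y k - y i) \<le> c * (1 / 2) ^ i" if "j \<le> i" "i \<le> k" for i k
  proof -
    have "norm (y k - y i) \<le> c * ((1 / 2) ^ i - (1 / 2) ^ k)"
      using step[OF that(1), of "k - i"] that(2) by simp
    also have "\<dots> \<le> c * (1 / 2) ^ i" using \<open>c \<ge> 0\<close> by (intro mult_left_mono) auto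
    finally show ?thesis .
  qed
  have lim0: "(\<lambda>i. c * (1 / 2) ^ i) \<longlonglongrightarrow> 0"
    by (intro tendsto_mult_right_zero LIMSEQ_power_zero) simp
  have "Cauchy y"
    unfolding Cauchy_altdef2
  proof (intro allI impI)
    fix e :: real assume "e > 0"
    then have "\<forall>\<^sub>F i in sequentially. c * (1 / 2) ^ i < e \<and> i \<ge> j"
      using order_tendstoD(2)[OF lim0] eventually_ge_at_top by (intro eventually_conj) auto
    then obtain i where "c * (1 / 2) ^ i < e" "i \<ge> j"
      using eventually_happens sequentially_bot by blast
    then show "\<exists>N. \<forall>n\<ge>N. dist (y n) (y N) < e"
      using bound[of i] by (intro exI[of _ i]) (force simp: dist_norm)
  qed
  then show conv: "convergent y" by (rule Cauchy_convergent)
  have "(\<lambda>k. norm (y k - y j)) \<longlonglongrightarrow> norm (lim y - y j)"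
    using conv by (intro tendsto_intros) (simp add: convergent_LIMSEQ_iff)
  then show "norm (lim y - y j) \<le> c * (1 / 2) ^ j"
    by (rule LIMSEQ_le_const2) (use bound in blast)
qed

section \<open>Almost surely hypercyclic limits\<close>

text \<open>The tail condition at step \<open>i\<close> carries the constant \<open>M i\<close>
  inherited from earlier steps, whereas the iterates used at step \<open>i\<close> are bounded by
  \<open>M (Suc i)\<close>. Increments after \<open>Suc i\<close> are thus small relative to those
  iterates.\<close>

lemma ex_steinhaus_sequence:
  fixes T :: "'a::{complex_normed_vector, second_countable_topology} \<Rightarrow> 'a" and w :: "nat \<Rightarrow> 'a"
  assumes T: "bounded_operator T" and "p > 0" and type: "has_type p TYPE('a)"
    and hyp: "small_independent_eigenvectors T p C"
    and J: "finite J" "\<forall>j\<in>J. \<exists>c. unimodular_eigenvector T (x j) c" and "\<eta> > 0"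
  obtains Y M where "Y 0 = steinhaus_sum J x" "\<And>i::nat. M i \<ge> (1::real)" "mono M"
    "\<And>i. \<exists>J x. finite J \<and> (\<forall>j\<in>J. \<exists>c. unimodular_eigenvector T (x j) c) \<and> Y i = steinhaus_sum J x"
    "\<And>i. measure steinhaus_space {\<omega> \<in> space steinhaus_space.
       \<eta> * (1 / 2) ^ Suc i \<le> M i * norm (Y (Suc i) \<omega> - Y i \<omega>)} \<le> \<eta> * (1 / 2) ^ Suc i"
    "\<And>i \<omega>. \<forall>k. cmod (\<omega> k) = 1 \<Longrightarrow> \<exists>n. (\<forall>y. norm ((T ^^ n) y) \<le> M (Suc i) * norm y) \<and>
       norm ((T ^^ n) (Y (Suc i) \<omega>) - (Y i \<omega> + w i)) < (1 / 2) ^ i"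
proof -
  define P where "P s \<longleftrightarrow> (case s of (J, x, M::real) \<Rightarrow>
    finite J \<and> (\<forall>j\<in>J. \<exists>c. unimodular_eigenvector T (x j) c) \<and> 1 \<le> M)"
    for s :: "nat set \<times> (nat \<Rightarrow> 'a) \<times> real"
  define S where "S s = (case s of (J, x, M::real) \<Rightarrow> steinhaus_sum J x)" for s :: "nat set \<times> (nat \<Rightarrow> 'a) \<times> real"
  define M where "M s = (case s of (J, x, M::real) \<Rightarrow> M)" for s :: "nat set \<times> (nat \<Rightarrow> 'a) \<times> real"
  define Q where "Q i s s' \<longleftrightarrow> M s \<le> M s' \<and>
     measure steinhaus_space {\<omega> \<in> space steinhaus_space.
       \<eta> * (1 / 2) ^ Suc i \<le> M s * norm (S s' \<omega> - S s \<omega>)} \<le> \<eta> * (1 / 2) ^ Suc i \<and>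
     (\<forall>\<omega>. (\<forall>k. cmod (\<omega> k) = 1) \<longrightarrow> (\<exists>n. (\<forall>y. norm ((T ^^ n) y) \<le> M s' * norm y) \<and>
       norm ((T ^^ n) (S s' \<omega>) - (S s \<omega> + w i)) < (1 / 2) ^ i))" for i s s'
  have "\<exists>s'. P s' \<and> Q i s s'" if "P s" for s i
  proof -
    obtain J x m where s: "s = (J, x, m)" by (cases s)
    have J: "finite J" "\<forall>j\<in>J. \<exists>c. unimodular_eigenvector T (x j) c" and m: "1 \<le> m"
      using that by (auto simp: P_def s)
    have pos: "(1 / 2 :: real) ^ i > 0" "m > 0" "\<eta> * (1 / 2) ^ Suc i > 0"
      using m \<open>\<eta> > 0\<close> by (auto simp del: power_Suc)
    obtain J' x' m' where n: "finite J'" "\<forall>j\<in>J'. \<exists>c. unimodular_eigenvector T (x' j) c" "m \<le> m'"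
      "measure steinhaus_space {\<omega> \<in> space steinhaus_space.
         \<eta> * (1 / 2) ^ Suc i \<le> m * norm (steinhaus_sum J' x' \<omega> - steinhaus_sum J x \<omega>)} \<le> \<eta> * (1 / 2) ^ Suc i"
      "\<forall>\<omega>. (\<forall>k. cmod (\<omega> k) = 1) \<longrightarrow> (\<exists>n. (\<forall>y. norm ((T ^^ n) y) \<le> m' * norm y) \<and>
         norm ((T ^^ n) (steinhaus_sum J' x' \<omega>) - (steinhaus_sum J x \<omega> + w i)) < (1 / 2) ^ i)"
      using ex_steinhaus_extension[OF T \<open>p > 0\<close> type hyp J pos, of "w i"] by (elim exE conjE)
    show ?thesis
      using n m by (intro exI[of _ "(J', x', m')"]) (simp add: P_def Q_def S_def M_def s del: power_Suc)
  qed
  moreover have "P (J, x, 1)" using J by (simp add: P_def)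
  \<comment> \<open>The clause for \<open>i = 0\<close> in the invariant fixes the starting state of
    the dependent choice.\<close>
  ultimately obtain s where s: "s 0 = (J, x, 1)" "\<And>i. P (s i)" "\<And>i. Q i (s i) (s (Suc i))"
    using dependent_nat_choice[of "\<lambda>i s. P s \<and> (i = 0 \<longrightarrow> s = (J, x, 1))" Q] by blast
  show ?thesis
  proof (rule that[of "\<lambda>i. S (s i)" "\<lambda>i. M (s i)"])
    show "S (s 0) = steinhaus_sum J x" by (simp add: s(1) S_def)
    show "1 \<le> M (s i)" for i using s(2)[of i] by (auto simp: P_def M_def)
    show "mono (\<lambda>i. M (s i))" using s(3) by (auto simp: Q_def mono_iff_le_Suc)
    show "\<exists>J x. finite J \<and> (\<forall>j\<in>J. \<exists>c. unimodular_eigenvector T (x j) c) \<and> S (s i) = steinhaus_sum J x" for i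
      using s(2)[of i] by (cases "s i") (auto simp: P_def S_def)
  qed (use s(3) in \<open>simp_all add: Q_def del: power_Suc\<close>)
qed

text \<open>The bad events \<open>A i\<close> have geometrically small probabilities. Their total
  controls the distance from \<open>Y 0\<close> to the limit, and Borel-Cantelli makes almost every
  \<open>\<omega>\<close> eventually good, where density of the orbit is checked pointwise.\<close>

lemma ex_hypercyclic_limit:
  fixes T :: "'a::complex_separable_banach \<Rightarrow> 'a"
  assumes T: "bounded_operator T" and "p > 0" and type: "has_type p TYPE('a)"
    and hyp: "small_independent_eigenvectors T p C"
    and J: "finite J" "\<forall>j\<in>J. \<exists>c. unimodular_eigenvector T (x j) c" and "\<eta> > 0"
  obtains X where "X \<in> borel_measurable steinhaus_space"
    "AE \<omega> in steinhaus_space. X \<omega> \<in> HC T"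
    "prokhorov_dist (distr steinhaus_space borel (steinhaus_sum J x)) (distr steinhaus_space borel X) < \<eta>"
    "distr steinhaus_space borel X \<in> steinhaus_closure T"
proof -
  interpret prob_space steinhaus_space by (rule prob_space_steinhaus_space)
  obtain w :: "nat \<Rightarrow> 'a" where w: "\<And>v e N. e > 0 \<Longrightarrow> \<exists>i\<ge>N. norm (w i - v) < e"
    using ex_recurrent_dense_sequence by metis
  define c where "c = \<eta> / 2"
  have c: "c > 0" "c < \<eta>" using \<open>\<eta> > 0\<close> by (auto simp: c_def)
  obtain Y M where Y0: "Y 0 = steinhaus_sum J x" and M1: "\<And>i::nat. M i \<ge> (1::real)" and "mono M"
    and Y: "\<And>i. \<exists>J x. finite J \<and> (\<forall>j\<in>J. \<exists>c. unimodular_eigenvector T (x j) c) \<and> Y i = steinhaus_sum J x"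
    and tail: "\<And>i. measure steinhaus_space {\<omega> \<in> space steinhaus_space.
       c * (1 / 2) ^ Suc i \<le> M i * norm (Y (Suc i) \<omega> - Y i \<omega>)} \<le> c * (1 / 2) ^ Suc i"
    and approx: "\<And>i \<omega>. \<forall>k. cmod (\<omega> k) = 1 \<Longrightarrow> \<exists>n. (\<forall>y. norm ((T ^^ n) y) \<le> M (Suc i) * norm y) \<and>
       norm ((T ^^ n) (Y (Suc i) \<omega>) - (Y i \<omega> + w i)) < (1 / 2) ^ i"
    by (rule ex_steinhaus_sequence[OF T \<open>p > 0\<close> type hyp J c(1), of w]) (rule that)
  have Ym [measurable]: "Y i \<in> borel_measurable steinhaus_space" for i
  proof -
    obtain J x where "Y i = steinhaus_sum J x" using Y by blast
    then show ?thesis by simp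
  qed
  define X where "X \<omega> = lim (\<lambda>i. Y i \<omega>)" for \<omega>
  have Xm [measurable]: "X \<in> borel_measurable steinhaus_space" unfolding X_def by measurable
  define A where "A i = {\<omega> \<in> space steinhaus_space. c * (1 / 2) ^ Suc i \<le> M i * norm (Y (Suc i) \<omega> - Y i \<omega>)}" for i
  have Am [measurable]: "A i \<in> sets steinhaus_space" for i unfolding A_def by measurable
  have A: "prob (A i) \<le> c * (1 / 2) ^ Suc i" for i using tail by (simp add: A_def)
  \<comment> \<open>The factor \<open>1 / M j\<close>, available because \<open>M\<close> is
    monotone, later absorbs the norm of the iterate applied to this remainder.\<close>
  have close: "norm (X \<omega> - Y j \<omega>) \<le> c / M j * (1 / 2) ^ j" if "\<And>l. j \<le> l \<Longrightarrow> \<omega> \<notin> A l" for j \<omega>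
    unfolding X_def
  proof (rule geometric_increments_limit(2))
    show "0 \<le> c / M j" using c M1[of j] by simp
    fix l assume "j \<le> l"
    have "M j * norm (Y (Suc l) \<omega> - Y l \<omega>) \<le> M l * norm (Y (Suc l) \<omega> - Y l \<omega>)"
      using \<open>mono M\<close> \<open>j \<le> l\<close> by (intro mult_right_mono) (auto simp: mono_def)
    also have "\<dots> \<le> c * (1 / 2) ^ Suc l" using that[OF \<open>j \<le> l\<close>] by (simp add: A_def del: power_Suc)
    finally show "norm (Y (Suc l) \<omega> - Y l \<omega>) \<le> c / M j * (1 / 2) ^ Suc l"
      using M1[of j] by (simp add: field_simps del: power_Suc)
  qed
  have sumA: "prob (\<Union>l. A (l + i)) \<le> c * (1 / 2) ^ i" for i
  proof -
    have le: "prob (A (l + i)) \<le> c * (1 / 2) ^ i * (1 / 2) ^ Suc l" for l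
      using A[of "l + i"] by (simp add: power_add mult_ac)
    have sums: "(\<lambda>l. c * (1 / 2) ^ i * (1 / 2) ^ Suc l) sums (c * (1 / 2) ^ i * 1)"
      by (intro sums_mult power_half_series)
    have summ: "summable (\<lambda>l. prob (A (l + i)))"
      by (rule summable_comparison_test'[OF sums_summable[OF sums], of 0]) (use le in auto)
    have "prob (\<Union>l. A (l + i)) \<le> (\<Sum>l. prob (A (l + i)))"
      by (rule finite_measure_subadditive_countably[OF _ summ]) auto
    also have "\<dots> \<le> (\<Sum>l. c * (1 / 2) ^ i * (1 / 2) ^ Suc l)"
      by (rule suminf_le[OF le summ sums_summable[OF sums]])
    also have "\<dots> = c * (1 / 2) ^ i" using sums_unique[OF sums] by simp
    finally show ?thesis .
  qed
  \<comment> \<open>The first order of arguments serves membership in the closure, the second the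
    distance from the initial measure.\<close>
  have dist_le: "prokhorov_dist (distr steinhaus_space borel X) (distr steinhaus_space borel (Y i)) \<le> e"
    "prokhorov_dist (distr steinhaus_space borel (Y i)) (distr steinhaus_space borel X) \<le> e"
    if e: "c * (1 / 2) ^ i < e" for i e
  proof -
    have "0 < e" using e c(1) by (smt (verit) zero_less_mult_iff zero_less_power zero_less_divide_1_iff)
    have "{\<omega> \<in> space steinhaus_space. norm (X \<omega> - Y i \<omega>) \<ge> e} \<subseteq> (\<Union>l. A (l + i))"
    proof (rule subsetI, rule ccontr)
      fix \<omega> assume \<omega>: "\<omega> \<in> {\<omega> \<in> space steinhaus_space. norm (X \<omega> - Y i \<omega>) \<ge> e}" "\<omega> \<notin> (\<Union>l. A (l + i))"
      have "\<omega> \<notin> A l" if "i \<le> l" for l using \<omega>(2) that by (metis UN_I UNIV_I le_add_diff_inverse2)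
      then have "norm (X \<omega> - Y i \<omega>) \<le> c / M i * (1 / 2) ^ i" by (rule close)
      also have "\<dots> \<le> c * (1 / 2) ^ i"
        using c M1[of i] by (intro mult_right_mono) (auto simp: divide_le_eq mult_le_cancel_left1)
      finally show False using \<omega>(1) e by simp
    qed
    then have "prob {\<omega> \<in> space steinhaus_space. norm (X \<omega> - Y i \<omega>) \<ge> e} \<le> prob (\<Union>l. A (l + i))"
      by (intro finite_measure_mono) auto
    then have small: "prob {\<omega> \<in> space steinhaus_space. norm (X \<omega> - Y i \<omega>) \<ge> e} \<le> e"
      using sumA[of i] e by linarith
    show "prokhorov_dist (distr steinhaus_space borel X) (distr steinhaus_space borel (Y i)) \<le> e"
      by (rule prokhorov_dist_distr_le[OF prob_space_steinhaus_space Xm Ym \<open>0 < e\<close> small])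
    show "prokhorov_dist (distr steinhaus_space borel (Y i)) (distr steinhaus_space borel X) \<le> e"
      using small by (intro prokhorov_dist_distr_le[OF prob_space_steinhaus_space Ym Xm \<open>0 < e\<close>])
        (simp add: norm_minus_commute)
  qed
  have probs: "distr steinhaus_space borel Z \<in> borel_probs" if "Z \<in> borel_measurable steinhaus_space"
    for Z :: "(nat \<Rightarrow> complex) \<Rightarrow> 'a"
    using that by (auto simp: borel_probs_def intro: prob_space_distr)
  have half: "\<forall>\<^sub>F i in sequentially. b * (1 / 2) ^ i < e" if "e > 0" for b e :: real
  proof -
    have "(\<lambda>i. b * (1 / 2) ^ i) \<longlonglongrightarrow> 0"
      by (intro tendsto_mult_right_zero LIMSEQ_power_zero) simp
    then show ?thesis using that by (rule order_tendstoD(2))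
  qed

  have closure: "distr steinhaus_space borel X \<in> steinhaus_closure T"
    unfolding steinhaus_closure_def
  proof (rule prokhorov_closure_ofI[OF probs[OF Xm]])
    fix e :: real assume "e > 0"
    then obtain i where i: "c * (1 / 2) ^ i < e / 2"
      using eventually_happens[OF half[of "e / 2" c]] by auto
    obtain J x where Jx: "finite J" "\<forall>j\<in>J. \<exists>c. unimodular_eigenvector T (x j) c" "Y i = steinhaus_sum J x"
      using Y by blast
    have "distr steinhaus_space borel (Y i) \<in> steinhaus_measures T"
      unfolding steinhaus_measures_def Jx(3) distr_steinhaus_sum[OF Jx(1), symmetric]
      using Jx(1,2) by blast
    moreover have "prokhorov_dist (distr steinhaus_space borel X) (distr steinhaus_space borel (Y i)) < e"
      using dist_le(1)[OF i] \<open>e > 0\<close> by simp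
    ultimately show "\<exists>N\<in>steinhaus_measures T \<inter> borel_probs. prokhorov_dist (distr steinhaus_space borel X) N < e"
      using probs[OF Ym] by blast
  qed

  have "summable (\<lambda>i. prob (A i))"
    by (rule summable_comparison_test'[OF sums_summable[OF sums_mult[OF power_half_series, of c]], of 0])
      (use A in \<open>auto simp del: power_Suc\<close>)
  then have "AE \<omega> in steinhaus_space. \<forall>\<^sub>F i in sequentially. \<omega> \<in> space steinhaus_space - A i"
    by (intro borel_cantelli_AE1) (auto simp: emeasure_eq_measure)
  then have HC: "AE \<omega> in steinhaus_space. X \<omega> \<in> HC T"
    using AE_steinhaus_space_cmod
  proof eventually_elim
    case (elim \<omega>)
    then obtain i0 where i0: "\<And>i. i0 \<le> i \<Longrightarrow> \<omega> \<notin> A i" by (auto simp: eventually_sequentially)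
    have "\<exists>n. dist ((T ^^ n) (X \<omega>)) v < e" if "e > 0" for v e
    proof -
      have "\<forall>\<^sub>F i in sequentially. c * (1 / 2) ^ i < e / 4 \<and> 1 * (1 / 2) ^ i < e / 4 \<and> i0 \<le> i"
        using \<open>e > 0\<close> by (intro eventually_conj half eventually_ge_at_top) auto
      then obtain i1 where i1: "\<And>i. i1 \<le> i \<Longrightarrow> c * (1 / 2) ^ i < e / 4 \<and> (1 / 2) ^ i < e / 4 \<and> i0 \<le> i"
        unfolding eventually_sequentially by auto
      \<comment> \<open>The target is fixed only after \<open>\<omega>\<close>, and \<open>i\<close>
        must also lie beyond the last bad event; hence the recurrence built into
        \<open>w\<close>.\<close>
      obtain i where "i1 \<le> i" and wi: "norm (w i - (v - X \<omega>)) < e / 4"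
        using w[of "e / 4" i1 "v - X \<omega>"] \<open>e > 0\<close> by auto
      note i = i1[OF \<open>i1 \<le> i\<close>]
      obtain n where n: "\<And>y. norm ((T ^^ n) y) \<le> M (Suc i) * norm y"
        "norm ((T ^^ n) (Y (Suc i) \<omega>) - (Y i \<omega> + w i)) < (1 / 2) ^ i"
        using approx[OF elim(2), of i] by blast
      have c1: "norm (X \<omega> - Y i \<omega>) < e / 4"
      proof -
        have "norm (X \<omega> - Y i \<omega>) \<le> c / M i * (1 / 2) ^ i"
          using i i0 by (intro close) auto
        also have "\<dots> \<le> c * (1 / 2) ^ i"
          using c M1[of i] by (intro mult_right_mono) (auto simp: divide_le_eq mult_le_cancel_left1)
        finally show ?thesis using i by linarith
      qed
      have c2: "norm ((T ^^ n) (X \<omega> - Y (Suc i) \<omega>)) < e / 4"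
      proof -
        have "norm ((T ^^ n) (X \<omega> - Y (Suc i) \<omega>)) \<le> M (Suc i) * norm (X \<omega> - Y (Suc i) \<omega>)" by (rule n(1))
        also have "\<dots> \<le> M (Suc i) * (c / M (Suc i) * (1 / 2) ^ Suc i)"
          using i i0 M1[of "Suc i"] by (intro mult_left_mono close) auto
        also have "\<dots> = c * (1 / 2) ^ Suc i" using M1[of "Suc i"] by simp
        finally show ?thesis using i1[of "Suc i"] \<open>i1 \<le> i\<close> by linarith
      qed
      \<comment> \<open>Four errors of size below \<open>e / 4\<close>: the remainder after block
        \<open>i\<close>, the Kronecker step, the choice of \<open>w i\<close>, and the replacement
        of \<open>X \<omega>\<close> by \<open>Y i \<omega>\<close>.\<close>
      have "(T ^^ n) (X \<omega>) - v = (T ^^ n) (X \<omega> - Y (Suc i) \<omega>)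
          + ((T ^^ n) (Y (Suc i) \<omega>) - (Y i \<omega> + w i)) + (w i - (v - X \<omega>)) - (X \<omega> - Y i \<omega>)"
        by (simp add: linear_diff[OF bounded_linear.linear[OF bounded_operator_funpow(1)[OF T]]])
      also have "norm \<dots> \<le> norm ((T ^^ n) (X \<omega> - Y (Suc i) \<omega>))
          + norm ((T ^^ n) (Y (Suc i) \<omega>) - (Y i \<omega> + w i)) + norm (w i - (v - X \<omega>)) + norm (X \<omega> - Y i \<omega>)"
        by (intro norm_triangle_le_diff norm_triangle_le add_mono order_refl)
      also have "\<dots> < e" using c1 c2 wi n(2) i by linarith
      finally show ?thesis by (auto simp: dist_norm)
    qed
    then show "X \<omega> \<in> HC T" unfolding HC_def by (auto simp: closure_approachable)
  qed
  have "prokhorov_dist (distr steinhaus_space borel (steinhaus_sum J x)) (distr steinhaus_space borel X) < \<eta>"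
    using dist_le(2)[of 0 "(c + \<eta>) / 2"] c unfolding Y0 by simp
  with Xm HC closure show ?thesis using that by blast
qed

theorem proposition5:
  fixes T :: "'a::complex_separable_banach \<Rightarrow> 'a" and p C :: real
  assumes "bounded_operator T"
    and "1 < p" and "p \<le> 2"
    and "has_type p TYPE('a)"
    and "\<forall>\<Omega>::'a set. open \<Omega> \<and> \<Omega> \<noteq> {} \<and> T -` \<Omega> \<subseteq> \<Omega> \<longrightarrow>
           (\<exists>K::nat set. \<exists>u::nat \<Rightarrow> 'a. \<exists>lam::nat \<Rightarrow> complex. finite K \<and>
              (\<forall>k\<in>K. unimodular_eigenvector T (u k) (lam k)) \<and> independent_family K lam \<and>
              (\<Sum>k\<in>K. u k) \<in> \<Omega> \<and> (\<Sum>k\<in>K. norm (u k) powr p) \<le> C)"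
  shows "gdelta_in (subtopology prokhorov_topology (steinhaus_closure T)) (steinhaus_closure_on T (HC T))
    \<and> (subtopology prokhorov_topology (steinhaus_closure T)) closure_of (steinhaus_closure_on T (HC T))
        = steinhaus_closure T"
proof
  have cont: "continuous_on UNIV T"
    using assms(1) by (auto simp: bounded_operator_def intro: linear_continuous_on)
  have sub: "steinhaus_closure T \<subseteq> borel_probs"
    unfolding steinhaus_closure_def topspace_prokhorov[symmetric] by (rule closure_of_subset_topspace)
  show "gdelta_in (subtopology prokhorov_topology (steinhaus_closure T)) (steinhaus_closure_on T (HC T))"
    unfolding steinhaus_closure_on_def by (rule gdelta_prokhorov_HC(2)[OF cont sub])
  have HCb: "HC T \<in> sets borel" by (rule gdelta_prokhorov_HC(1)[OF cont sub])
  have hyp: "small_independent_eigenvectors T p C"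
    using assms(5) unfolding small_independent_eigenvectors_def .
  have p: "p > 0" using assms(2) by simp
  let ?D = "steinhaus_closure_on T (HC T)"
  \<comment> \<open>It suffices to approximate Steinhaus measures themselves, since a closure is
    closed and \<open>steinhaus_closure T\<close> is the least closed set containing them.\<close>
  have "steinhaus_measures T \<subseteq> prokhorov_topology closure_of ?D"
  proof
    fix m assume "m \<in> steinhaus_measures T"
    then obtain J :: "nat set" and x where J: "finite J" "\<forall>j\<in>J. \<exists>c. unimodular_eigenvector T (x j) c"
      and m: "m = distr (PiM J (\<lambda>_. circle_uniform)) borel (\<lambda>ch. \<Sum>j\<in>J. ch j *\<^sub>C x j)"
      unfolding steinhaus_measures_def by blast
    have m': "m = distr steinhaus_space borel (steinhaus_sum J x)"
      unfolding m by (rule distr_steinhaus_sum[OF J(1)])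
    interpret prob_space steinhaus_space by (rule prob_space_steinhaus_space)
    show "m \<in> prokhorov_topology closure_of ?D"
    proof (rule prokhorov_closure_ofI)
      show "m \<in> borel_probs" unfolding m' by (auto simp: borel_probs_def intro: prob_space_distr)
      fix e :: real assume "e > 0"
      obtain X where X [measurable]: "X \<in> borel_measurable steinhaus_space"
        and HC: "AE \<omega> in steinhaus_space. X \<omega> \<in> HC T"
        and dist: "prokhorov_dist (distr steinhaus_space borel (steinhaus_sum J x)) (distr steinhaus_space borel X) < e"
        and cl: "distr steinhaus_space borel X \<in> steinhaus_closure T"
        by (rule ex_hypercyclic_limit[OF assms(1) p assms(4) hyp J \<open>e > 0\<close>]) (rule that)
      have "prob (X -` HC T \<inter> space steinhaus_space) = 1"
        using HC measurable_sets[OF X HCb] by (subst prob_eq_1) auto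
      then have "emeasure (distr steinhaus_space borel X) (HC T) = 1"
        using HCb by (simp add: emeasure_distr emeasure_eq_measure)
      then have "distr steinhaus_space borel X \<in> ?D \<inter> borel_probs"
        using cl sub by (auto simp: steinhaus_closure_on_def)
      with dist[folded m'] show "\<exists>N\<in>?D \<inter> borel_probs. prokhorov_dist m N < e" by blast
    qed
  qed
  then have "steinhaus_closure T \<subseteq> prokhorov_topology closure_of ?D"
    unfolding steinhaus_closure_def[of T] by (intro closure_of_minimal closedin_closure_of)
  moreover have "steinhaus_closure T \<inter> ?D = ?D" by (auto simp: steinhaus_closure_on_def)
  ultimately show "subtopology prokhorov_topology (steinhaus_closure T) closure_of ?D = steinhaus_closure T"
    unfolding closure_of_subtopology by auto
qed

end
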